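(* Let $k \geq 2$ be an integer, let $G$ be a $2k$-edge-connected, locally finite graph, and let $A$ be a finite set of vertices of $G$ such that each connected component of $G-A$ is boundary-linked. Then there is a set of vertices $X \subseteq V(G)\setminus A$ containing at most one vertex from each component of $G-A$ such that $G$ contains an immersion, on $A \cup X$, of a finite, $3$-edge-connected multigraph $H$ with vertex set $A\cup X$ with the following properties: (i) $d_H(x) = 3$ for all $x \in X$; (ii) $\lambda_H(a,b) \geq 2k$ for all distinct $a,b \in A$; (iii) every edge of $G$ between two vertices of $A$ is also an edge of $H$ (i.e. it is an edge of $H$ whose corresponding path in the immersion is that edge itself).
   Context: For a set of vertices $B$, its boundary is the set of edges of $G$ with exactly one endvertex in $B$. Two rays of $G$ are equivalent if there are infinitely many pairwise vertex-disjoint paths between them in $G$. A set of vertices $B$ is boundary-linked if $G[B]$ together with the boundary edges of $B$ contains a collection of pairwise edge-disjoint, pairwise equivalent rays $R_1,R_2,\ldots$ such that each boundary edge of $B$ is the first edge of one of the $R_i$. If $H$ is a multigraph with vertices $x_1,\ldots,x_n$, an immersion of $H$ in $G$ on $\{y_1,\ldots,y_n\}$ is a subgraph of $G$ consisting of $n$ distinct distinguished vertices $y_1,\ldots,y_n$ (with $y_i$ corresponding to $x_i$) and a collection of pairwise edge-disjoint paths in $G$ such that for each edge $x_ix_j$ of $H$ (counted with multiplicity) there is a corresponding path in the collection from $y_i$ to $y_j$. $d_H(x)$ denotes the degree of $x$ in $H$ and $\lambda_H(a,b)$ the maximum number of pairwise edge-disjoint $a$–$b$ paths in $H$. *)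

theory Defs
  imports Main
begin

definition simple_graph :: "'v set \<Rightarrow> 'v set set \<Rightarrow> bool" where
  "simple_graph V E \<longleftrightarrow> (\<forall>e\<in>E. \<exists>u v. u \<noteq> v \<and> u \<in> V \<and> v \<in> V \<and> e = {u, v})"

definition locally_finite :: "'v set \<Rightarrow> 'v set set \<Rightarrow> bool" where
  "locally_finite V E \<longleftrightarrow> (\<forall>v\<in>V. finite {u. {u, v} \<in> E})"

definition connected_graph :: "'v set \<Rightarrow> 'v set set \<Rightarrow> bool" where
  "connected_graph V E \<longleftrightarrow> (\<forall>u\<in>V. \<forall>v\<in>V. (\<lambda>x y. {x, y} \<in> E)\<^sup>*\<^sup>* u v)"

definition edge_connected :: "nat \<Rightarrow> 'v set \<Rightarrow> 'v set set \<Rightarrow> bool" where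
  "edge_connected m V E \<longleftrightarrow>
     (\<forall>S. S \<subseteq> E \<and> finite S \<and> card S < m \<longrightarrow> connected_graph V (E - S))"

definition gpath :: "'v set \<Rightarrow> 'v set set \<Rightarrow> 'v list \<Rightarrow> bool" where
  "gpath V E xs \<longleftrightarrow> xs \<noteq> [] \<and> distinct xs \<and> set xs \<subseteq> V \<and>
     (\<forall>n. Suc n < length xs \<longrightarrow> {xs ! n, xs ! Suc n} \<in> E)"

definition path_edges :: "'v list \<Rightarrow> 'v set set" where
  "path_edges xs = {{xs ! n, xs ! Suc n} | n. Suc n < length xs}"

definition ray :: "'v set \<Rightarrow> 'v set set \<Rightarrow> (nat \<Rightarrow> 'v) \<Rightarrow> bool" where
  "ray V E r \<longleftrightarrow> inj r \<and> (\<forall>n. r n \<in> V \<and> {r n, r (Suc n)} \<in> E)"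

definition ray_edges :: "(nat \<Rightarrow> 'v) \<Rightarrow> 'v set set" where
  "ray_edges r = {{r n, r (Suc n)} | n. True}"

definition equivalent_rays :: "'v set \<Rightarrow> 'v set set \<Rightarrow> (nat \<Rightarrow> 'v) \<Rightarrow> (nat \<Rightarrow> 'v) \<Rightarrow> bool" where
  "equivalent_rays V E r s \<longleftrightarrow>
     (\<exists>P. infinite P \<and>
          (\<forall>p\<in>P. gpath V E p \<and> hd p \<in> range r \<and> last p \<in> range s) \<and>
          (\<forall>p\<in>P. \<forall>q\<in>P. p \<noteq> q \<longrightarrow> set p \<inter> set q = {}))"

definition boundary :: "'v set set \<Rightarrow> 'v set \<Rightarrow> 'v set set" where
  "boundary E B = {e \<in> E. card (e \<inter> B) = 1}"

definition boundary_linked :: "'v set \<Rightarrow> 'v set set \<Rightarrow> 'v set \<Rightarrow> bool" where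
  "boundary_linked V E B \<longleftrightarrow>
     (\<exists>R. (\<forall>r\<in>R. ray V E r \<and> ray_edges r \<subseteq> {e \<in> E. e \<subseteq> B} \<union> boundary E B) \<and>
          (\<forall>r\<in>R. \<forall>s\<in>R. r \<noteq> s \<longrightarrow> ray_edges r \<inter> ray_edges s = {}) \<and>
          (\<forall>r\<in>R. \<forall>s\<in>R. equivalent_rays V E r s) \<and>
          (\<forall>e\<in>boundary E B. \<exists>r\<in>R. {r 0, r 1} = e))"

definition component_minus :: "'v set \<Rightarrow> 'v set set \<Rightarrow> 'v set \<Rightarrow> 'v set \<Rightarrow> bool" where
  "component_minus V E A C \<longleftrightarrow>
     (\<exists>u \<in> V - A. C = {v. (\<lambda>x y. x \<in> V - A \<and> y \<in> V - A \<and> {x, y} \<in> E)\<^sup>*\<^sup>* u v})"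

definition multigraph :: "'v set \<Rightarrow> nat set \<Rightarrow> (nat \<Rightarrow> 'v \<times> 'v) \<Rightarrow> bool" where
  "multigraph W F ends \<longleftrightarrow> finite W \<and> finite F \<and>
     (\<forall>i\<in>F. fst (ends i) \<in> W \<and> snd (ends i) \<in> W \<and> fst (ends i) \<noteq> snd (ends i))"

definition mdeg :: "nat set \<Rightarrow> (nat \<Rightarrow> 'v \<times> 'v) \<Rightarrow> 'v \<Rightarrow> nat" where
  "mdeg F ends x = card {i \<in> F. fst (ends i) = x \<or> snd (ends i) = x}"

definition medge_connected :: "nat \<Rightarrow> 'v set \<Rightarrow> nat set \<Rightarrow> (nat \<Rightarrow> 'v \<times> 'v) \<Rightarrow> bool" where
  "medge_connected m W F ends \<longleftrightarrow>
     (\<forall>S. S \<subseteq> F \<and> card S < m \<longrightarrow>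
        (\<forall>u\<in>W. \<forall>v\<in>W. (\<lambda>x y. \<exists>i \<in> F - S. ends i = (x, y) \<or> ends i = (y, x))\<^sup>*\<^sup>* u v))"

definition mpath :: "nat set \<Rightarrow> (nat \<Rightarrow> 'v \<times> 'v) \<Rightarrow> 'v \<Rightarrow> 'v \<Rightarrow> 'v list \<times> nat list \<Rightarrow> bool" where
  "mpath F ends a b p \<longleftrightarrow> (case p of (vs, es) \<Rightarrow>
     vs \<noteq> [] \<and> distinct vs \<and> hd vs = a \<and> last vs = b \<and> length vs = Suc (length es) \<and>
     (\<forall>n < length es. es ! n \<in> F \<and>
        (ends (es ! n) = (vs ! n, vs ! Suc n) \<or> ends (es ! n) = (vs ! Suc n, vs ! n))))"

definition mlambda :: "nat set \<Rightarrow> (nat \<Rightarrow> 'v \<times> 'v) \<Rightarrow> 'v \<Rightarrow> 'v \<Rightarrow> nat" where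
  "mlambda F ends a b = (GREATEST n. \<exists>p :: nat \<Rightarrow> 'v list \<times> nat list.
      (\<forall>i<n. mpath F ends a b (p i)) \<and>
      (\<forall>i<n. \<forall>j<n. i \<noteq> j \<longrightarrow> set (snd (p i)) \<inter> set (snd (p j)) = {}))"

text \<open>Immersion of H in G on its own vertex set (branch vertex y_x = x):
  for each edge i of H a path P i in G from fst (ends i) to snd (ends i),
  the paths pairwise edge-disjoint.\<close>
definition immersion :: "'v set \<Rightarrow> 'v set set \<Rightarrow> 'v set \<Rightarrow> nat set \<Rightarrow> (nat \<Rightarrow> 'v \<times> 'v)
    \<Rightarrow> (nat \<Rightarrow> 'v list) \<Rightarrow> bool" where
  "immersion V E W F ends P \<longleftrightarrow> W \<subseteq> V \<and>
     (\<forall>i\<in>F. gpath V E (P i) \<and> hd (P i) = fst (ends i) \<and> last (P i) = snd (ends i)) \<and>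
     (\<forall>i\<in>F. \<forall>j\<in>F. i \<noteq> j \<longrightarrow> path_edges (P i) \<inter> path_edges (P j) = {})"

end

theory Submission
  imports Defs
begin

text \<open>Contract every component \<open>C\<close> of \<open>G - A\<close> to a vertex and process these vertices one at a time,
  maintaining that every cut separating \<open>A\<close> has at least \<open>2k\<close> edges. Two star edges at such a
  vertex can be replaced in \<open>G\<close> by a path if their rays are adjacent in the auxiliary graph that joins
  two rays when they are connected infinitely often without using edges of the remaining rays. This
  auxiliary graph is connected. If the degree is even, uncrossing and parity show that some auxiliary edge
  is a pair that can be lifted without destroying the cut condition. If the degree is odd, the only
  obstruction is that the star edges are \<open>{e} \<union> P \<union> Q\<close> with \<open>|P| = |Q|\<close>, where every pair in \<open>P \<times> Q\<close>
  can be lifted and this structure persists. Then \<open>e\<close> has auxiliary neighbours \<open>p \<in> P\<close> and \<open>q \<in> Q\<close>; in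
  \<open>G\<close>, first link \<open>e, p, q\<close> to a common vertex \<open>x\<close> of degree 3, and then match the
  rest of \<open>P\<close> with the rest of \<open>Q\<close> along auxiliary edges. For the cut condition the order is reversed:
  the pairs are lifted first. At the end Menger's theorem turns the cut condition into edge-disjoint paths,
  and 3-edge-connectedness is clear since the vertices \<open>x\<close> have all their neighbours in \<open>A\<close>.\<close>

section \<open>Lifting at a vertex and dangerous sets\<close>

text \<open>Two demands compete at a contracted component: a pair of star edges may be replaced only
  if all cuts separating \<open>A\<close> survive and only if its two rays can be joined in
  \<open>G\<close>. A pair is blocked by cuts when both ends lie in one set whose cut has at most
  \<open>m + 1\<close> edges, because the lift lowers such a cut by 2. As the complement of this set
  must keep a cut of size \<open>m\<close> as well, the set contains at most half of the star ends,
  rounded up. Two such sets covering \<open>A\<close> therefore force an odd star with the exact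
  balance of \<open>P\<close> and \<open>Q\<close>; for suitably chosen sets that do not cover
  \<open>A\<close>, parity gives a contradiction, and here the evenness of \<open>m = 2k\<close>
  enters. The claw at \<open>x\<close> spends the rays of \<open>e\<close>, \<open>p\<close>,
  \<open>q\<close> but no edge of the others, so the auxiliary graph can be formed anew on the
  remaining rays and stays connected. Routes are kept as disjoint finite edge sets connecting their
  ends, so that joining routes is a union; paths are chosen only at the end. From
  \<open>k >= 2\<close> the cuts have at least 4 edges, which covers the 3 needed for
  \<open>H\<close> and excludes a star with a single edge.\<close>

definition cut_function :: "('v set \<Rightarrow> nat) \<Rightarrow> bool" where
  "cut_function d \<longleftrightarrow> (\<forall>X. d (- X) = d X) \<and>
     (\<forall>X Y. d (X \<inter> Y) + d (X \<union> Y) \<le> d X + d Y) \<and>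
     (\<forall>X Y. X \<inter> Y = {} \<longrightarrow> even (d (X \<union> Y) + d X + d Y))"

definition hits :: "'i set \<Rightarrow> ('i \<Rightarrow> 'v) \<Rightarrow> 'v set \<Rightarrow> nat" where
  "hits I a U = card {i \<in> I. a i \<in> U}"

definition splits :: "'v set \<Rightarrow> 'v set \<Rightarrow> bool" where
  "splits A U \<longleftrightarrow> A \<inter> U \<noteq> {} \<and> \<not> A \<subseteq> U"

lemma splits_Compl [simp]: "splits A (- U) \<longleftrightarrow> splits A U"
  by (auto simp: splits_def)

definition sep :: "'v \<Rightarrow> 'v \<Rightarrow> 'v set \<Rightarrow> nat" where
  "sep u v U = of_bool ((u \<in> U) \<noteq> (v \<in> U))"

lemma cut_function_sep: "cut_function (sep u v)"
  unfolding cut_function_def sep_def by auto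

text \<open>Cut functions are kept abstract so that a lift merely adds one term \<open>sep\<close>.
  The parity clause expresses that, for disjoint \<open>X\<close> and \<open>Y\<close>, the cut of
  the union differs from the sum of the two cuts by twice the number of edges between them.\<close>

lemma cut_function_add:
  assumes "cut_function f" "cut_function g"
  shows "cut_function (\<lambda>U. f U + g U)"
proof -
  have "even (f (X \<union> Y) + g (X \<union> Y) + (f X + g X) + (f Y + g Y))"
    if "X \<inter> Y = {}" for X Y
  proof -
    have "even (f (X \<union> Y) + f X + f Y)" "even (g (X \<union> Y) + g X + g Y)"
      using assms that by (auto simp: cut_function_def)
    then show ?thesis by presburger
  qed
  moreover have "f (X \<inter> Y) + g (X \<inter> Y) + (f (X \<union> Y) + g (X \<union> Y)) \<le> f X + g X + (f Y + g Y)" for X Y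
  proof -
    have "f (X \<inter> Y) + f (X \<union> Y) \<le> f X + f Y" "g (X \<inter> Y) + g (X \<union> Y) \<le> g X + g Y"
      using assms by (auto simp: cut_function_def)
    then show ?thesis by linarith
  qed
  ultimately show ?thesis using assms by (auto simp: cut_function_def)
qed

text \<open>Submodularity for \<open>X\<close> and \<open>- Y\<close>, rewritten by symmetry under
  complement.\<close>

lemma cut_function_posimodular:
  assumes "cut_function d"
  shows "d (X - Y) + d (Y - X) \<le> d X + d Y"
proof -
  have "d (X \<inter> - Y) + d (X \<union> - Y) \<le> d X + d (- Y)"
    using assms unfolding cut_function_def by blast
  moreover have "d (X \<union> - Y) = d (- (X \<union> - Y))" "d (- Y) = d Y"
    using assms unfolding cut_function_def by (simp_all only:)
  moreover have "- (X \<union> - Y) = Y - X" "X \<inter> - Y = X - Y" by auto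
  ultimately show ?thesis by simp
qed

lemma cut_function_Compl: "cut_function d \<Longrightarrow> d (- X) = d X"
  by (simp add: cut_function_def)

lemma hits_Un_Int:
  assumes "finite I"
  shows "hits I a (X \<inter> Y) + hits I a (X \<union> Y) = hits I a X + hits I a Y"
proof -
  have "{i \<in> I. a i \<in> X \<inter> Y} = {i \<in> I. a i \<in> X} \<inter> {i \<in> I. a i \<in> Y}"
    "{i \<in> I. a i \<in> X \<union> Y} = {i \<in> I. a i \<in> X} \<union> {i \<in> I. a i \<in> Y}" by auto
  then show ?thesis
    unfolding hits_def using card_Un_Int[of "{i \<in> I. a i \<in> X}" "{i \<in> I. a i \<in> Y}"] assms by simp
qed

lemma hits_empty [simp]: "hits I a {} = 0"
  by (simp add: hits_def)

lemma hits_Diff_Int: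
  assumes "finite I"
  shows "hits I a X = hits I a (X - Y) + hits I a (X \<inter> Y)"
proof -
  have "(X - Y) \<inter> (X \<inter> Y) = {}" "(X - Y) \<union> (X \<inter> Y) = X" by auto
  then show ?thesis using hits_Un_Int[OF assms, of a "X - Y" "X \<inter> Y"] by simp
qed

lemma hits_Compl:
  assumes "finite I"
  shows "hits I a X + hits I a (- X) = card I"
  using hits_Un_Int[OF assms, of a X "- X"] by (simp add: hits_def)

lemma hits_pos: "finite I \<Longrightarrow> i \<in> I \<Longrightarrow> a i \<in> X \<Longrightarrow> hits I a X \<ge> 1"
  unfolding hits_def using card_mono[of "{j \<in> I. a j \<in> X}" "{i}"] by simp

lemma hits_insert:
  "finite I \<Longrightarrow> i \<notin> I \<Longrightarrow> hits (insert i I) a U = of_bool (a i \<in> U) + hits I a U"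
proof -
  assume "finite I" "i \<notin> I"
  moreover have "{j \<in> insert i I. a j \<in> U} = (if a i \<in> U then insert i {j \<in> I. a j \<in> U} else {j \<in> I. a j \<in> U})"
    by auto
  ultimately show ?thesis by (simp add: hits_def)
qed

lemma hits_remove2:
  assumes "finite I" "i \<in> I" "j \<in> I" "i \<noteq> j"
  shows "hits I a U = of_bool (a i \<in> U) + of_bool (a j \<in> U) + hits (I - {i, j}) a U"
proof -
  have "I = insert i (insert j (I - {i, j}))" using assms by auto
  then show ?thesis using hits_insert[of "insert j (I - {i, j})" i a U] hits_insert[of "I - {i, j}" j a U] assms
    by simp
qed

text \<open>A vertex outside \<open>A\<close> with edges to the vertices \<open>a i\<close>, \<open>i \<in> I\<close>, added to a graph with cut
  function \<open>d\<close>. The sets \<open>U\<close> in the cut condition are the sides not containing that vertex.\<close>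

locale star =
  fixes A :: "'v set" and m :: nat and d :: "'v set \<Rightarrow> nat" and I :: "'i set" and a :: "'i \<Rightarrow> 'v"
  assumes even_m: "even m"
    and cutf: "cut_function d"
    and fin: "finite I"
    and ends_in: "a ` I \<subseteq> A"
    and ok: "splits A U \<Longrightarrow> m \<le> d U + hits I a U"
begin

section \<open>Dangerous sets and uncrossing\<close>

abbreviation "c U \<equiv> d U + hits I a U"

text \<open>The threshold is \<open>m + 1\<close> because lifting two star edges lowers
  \<open>c U\<close> by 2 if both end in \<open>U\<close>, and leaves \<open>c U\<close> unchanged
  otherwise.\<close>

definition dangerous :: "'v set \<Rightarrow> bool" where
  "dangerous U \<longleftrightarrow> splits A U \<and> c U \<le> m + 1"

lemma not_dangerous_lift:
  assumes ij: "i \<in> I" "j \<in> I" "i \<noteq> j"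
    and nd: "\<not> (\<exists>U. dangerous U \<and> a i \<in> U \<and> a j \<in> U)"
  shows "star A m (\<lambda>U. d U + sep (a i) (a j) U) (I - {i, j}) a"
proof
  show "cut_function (\<lambda>U. d U + sep (a i) (a j) U)"
    by (rule cut_function_add[OF cutf cut_function_sep])
  fix U assume U: "splits A U"
  have "c U \<ge> m" using ok[OF U] .
  moreover have "c U \<ge> m + 2" if "a i \<in> U" "a j \<in> U"
    using nd U that unfolding dangerous_def by force
  ultimately show "m \<le> d U + sep (a i) (a j) U + hits (I - {i, j}) a U"
    using hits_remove2[OF fin ij, of a U] by (auto split: if_splits simp: of_bool_def sep_def)
qed (use even_m fin ends_in in auto)

text \<open>The complement of \<open>U\<close> also splits \<open>A\<close>, so its cut, which
  contains the star edges not ending in \<open>U\<close>, has size at least \<open>m\<close>. For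
  dangerous \<open>U\<close> this bounds twice the number of hits by
  \<open>card I + 1\<close>.\<close>

lemma dangerous_hits:
  assumes "dangerous U"
  shows "2 * hits I a U + m \<le> c U + card I"
proof -
  have "m \<le> c (- U)" using assms ok[of "- U"] by (simp add: dangerous_def)
  then show ?thesis using cut_function_Compl[OF cutf, of U] hits_Compl[OF fin, of a U] by simp
qed

text \<open>Submodularity forces equality: \<open>c X = c Y = m + 1\<close> and
  \<open>c (X \<inter> Y) = m\<close>. The star edge \<open>i\<close> contributes to both
  \<open>c X\<close> and \<open>c Y\<close> but to neither difference, and this gain of 2 in the
  posimodular inequality gives \<open>c (X - Y) = m\<close>. Since \<open>X\<close> is the disjoint
  union of \<open>X - Y\<close> and \<open>X \<inter> Y\<close>, the sum of \<open>m + 1\<close>,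
  \<open>m\<close> and \<open>m\<close> would have to be even.\<close>

lemma uncross:
  assumes X: "dangerous X" and Y: "dangerous Y" and cover: "\<not> A \<subseteq> X \<union> Y"
    and i: "i \<in> I" "a i \<in> X" "a i \<in> Y"
    and XY: "A \<inter> (X - Y) \<noteq> {}" "A \<inter> (Y - X) \<noteq> {}"
    and big: "\<not> dangerous (X \<union> Y)"
  shows False
proof -
  have aA: "a i \<in> A" using ends_in i by auto
  have "splits A (X \<union> Y)" "splits A (X \<inter> Y)" "splits A (X - Y)" "splits A (Y - X)"
    using cover XY aA i by (auto simp: splits_def)
  then have *: "c (X \<union> Y) \<ge> m + 2" "c (X \<inter> Y) \<ge> m" "c (X - Y) \<ge> m" "c (Y - X) \<ge> m"
    using big ok by (auto simp: dangerous_def not_le)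
  have "d (X \<inter> Y) + d (X \<union> Y) \<le> d X + d Y" using cutf by (simp add: cut_function_def)
  then have "c X = m + 1" "c Y = m + 1" "c (X \<inter> Y) = m"
    using hits_Un_Int[OF fin, of a X Y] * X Y by (simp_all add: dangerous_def)
  moreover have hX: "hits I a X = hits I a (X - Y) + hits I a (X \<inter> Y)"
    by (rule hits_Diff_Int[OF fin])
  moreover have "hits I a Y = hits I a (Y - X) + hits I a (X \<inter> Y)"
    using hits_Diff_Int[OF fin, of a Y X] by (simp add: Int_commute)
  moreover have "hits I a (X \<inter> Y) \<ge> 1" using hits_pos[OF fin i(1), of a] i by auto
  moreover have "d (X - Y) + d (Y - X) \<le> d X + d Y" by (rule cut_function_posimodular[OF cutf])
  ultimately have "c (X - Y) = m" using * by linarith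
  have "(X - Y) \<inter> (X \<inter> Y) = {}" "(X - Y) \<union> (X \<inter> Y) = X" by auto
  then have "even (d X + d (X - Y) + d (X \<inter> Y))" using cutf unfolding cut_function_def by metis
  then have "even (c X + c (X - Y) + c (X \<inter> Y))" using hX by presburger
  then show False using \<open>c X = m + 1\<close> \<open>c (X - Y) = m\<close> \<open>c (X \<inter> Y) = m\<close> even_m by simp
qed

text \<open>The sets \<open>U\<close> and \<open>W\<close> are recorded because they witness that
  the structure persists: lifting a pair from \<open>P \<times> Q\<close> takes one star edge from
  each of them and puts the new edge across it, so both cuts remain \<open>m + 1\<close>.\<close>

definition exceptional :: "'i \<Rightarrow> 'i set \<Rightarrow> 'i set \<Rightarrow> bool" where
  "exceptional e P Q \<longleftrightarrow> I = insert e (P \<union> Q) \<and> e \<notin> P \<and> e \<notin> Q \<and> P \<inter> Q = {} \<and> card P = card Q \<and>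
     (\<exists>U W. dangerous U \<and> dangerous W \<and> A \<subseteq> U \<union> W \<and> c U = m + 1 \<and> c W = m + 1 \<and>
        {i \<in> I. a i \<in> U} = insert e P \<and> {i \<in> I. a i \<in> W} = insert e Q)"

lemma exceptionalE:
  assumes "exceptional e P Q"
  obtains U W where "I = insert e (P \<union> Q)" "e \<notin> P" "e \<notin> Q" "P \<inter> Q = {}" "card P = card Q"
    "dangerous U" "dangerous W" "A \<subseteq> U \<union> W" "c U = m + 1" "c W = m + 1"
    "{i \<in> I. a i \<in> U} = insert e P" "{i \<in> I. a i \<in> W} = insert e Q"
  using assms unfolding exceptional_def by blast

lemma exceptionalI:
  assumes "I = insert e (P \<union> Q)" "e \<notin> P" "e \<notin> Q" "P \<inter> Q = {}" "card P = card Q"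
    "dangerous U" "dangerous W" "A \<subseteq> U \<union> W" "c U = m + 1" "c W = m + 1"
    "{i \<in> I. a i \<in> U} = insert e P" "{i \<in> I. a i \<in> W} = insert e Q"
  shows "exceptional e P Q"
  using assms unfolding exceptional_def by blast

lemma exceptional_sym:
  assumes "exceptional e P Q"
  shows "exceptional e Q P"
  using assms
proof (rule exceptionalE, goal_cases)
  case (1 U W)
  have "I = insert e (Q \<union> P)" "Q \<inter> P = {}" "card Q = card P" "A \<subseteq> W \<union> U"
    using 1(1,4,5,8) by (simp_all only: Un_commute Int_commute)
  then show ?case using 1 by (intro exceptionalI[of e Q P W U])
qed

text \<open>Take a dangerous set hit by as many star edges as possible; an auxiliary edge leaving it
  yields a second dangerous set, and the two either uncross or cover \<^term>\<open>A\<close>.\<close>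

lemma exceptional_if_no_lift:
  assumes conn: "\<And>J. J \<subset> I \<Longrightarrow> J \<noteq> {} \<Longrightarrow> \<exists>i\<in>J. \<exists>j\<in>I - J. T i j"
    and nolift: "\<And>i j. i \<in> I \<Longrightarrow> j \<in> I \<Longrightarrow> i \<noteq> j \<Longrightarrow> T i j \<Longrightarrow> \<exists>U. dangerous U \<and> a i \<in> U \<and> a j \<in> U"
    and two: "card I \<ge> 2"
  obtains e P Q where "exceptional e P Q"
proof -
  let ?h = "hits I a"
  obtain i0 where i0: "i0 \<in> I" using two by fastforce
  have "{i0} \<subset> I" using i0 two by (auto simp: card_insert_if psubset_eq)
  then obtain j0 where "j0 \<in> I - {i0}" "T i0 j0" using conn[of "{i0}"] by auto
  then obtain U0 where "dangerous U0" "a i0 \<in> U0" using nolift[of i0 j0] i0 by blast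
  moreover have bd: "?h U \<le> card I" for U unfolding hits_def using fin by (simp add: card_mono)
  ultimately obtain U where U: "dangerous U" "a i0 \<in> U0" "?h U0 \<le> ?h U"
    and Umax: "\<And>W. dangerous W \<Longrightarrow> ?h W \<le> ?h U"
    using ex_has_greatest_nat[of dangerous U0 ?h "card I + 1"] by (metis less_Suc_eq_le Suc_eq_plus1)
  have half: "2 * ?h W \<le> card I + 1" if "dangerous W" for W
    using dangerous_hits[OF that] that by (simp add: dangerous_def)
  let ?J = "{i \<in> I. a i \<in> U}"
  have cJ: "card ?J = ?h U" by (simp add: hits_def)
  have "?h U \<ge> 1" using U hits_pos[OF fin i0, of a U0] by simp
  then have "?J \<noteq> {}" using cJ by force
  moreover have "?J \<noteq> I" using half[OF U(1)] cJ two by auto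
  ultimately obtain i j where ij: "i \<in> ?J" "j \<in> I - ?J" "T i j" using conn[of ?J] by blast
  then obtain W where W: "dangerous W" "a i \<in> W" "a j \<in> W" using nolift[of i j] by blast
  let ?K = "{i \<in> I. a i \<in> W}"
  have cK: "card ?K = ?h W" by (simp add: hits_def)
  have cover: "A \<subseteq> U \<union> W"
  proof (rule ccontr)
    assume nc: "\<not> A \<subseteq> U \<union> W"
    \<comment> \<open>Maximality of \<open>U\<close> is used twice: the union is hit too often to be
      dangerous, and \<open>U - W\<close> meets \<open>A\<close> because otherwise \<open>W\<close>
      would be hit more often than \<open>U\<close>.\<close>
    have "?J \<subset> {i \<in> I. a i \<in> U \<union> W}" using ij W by auto
    then have "?h U < ?h (U \<union> W)" unfolding hits_def using fin by (intro psubset_card_mono) auto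
    then have nd: "\<not> dangerous (U \<union> W)" using Umax by fastforce
    have "A \<inter> (U - W) \<noteq> {}"
    proof
      assume "A \<inter> (U - W) = {}"
      then have "?J \<subset> ?K" using ij W ends_in by auto
      then have "?h U < ?h W" unfolding hits_def using fin by (intro psubset_card_mono) auto
      then show False using Umax[OF W(1)] by simp
    qed
    moreover have "A \<inter> (W - U) \<noteq> {}" using ij W ends_in by auto
    ultimately show False using uncross[OF U(1) W(1) nc, of i] ij W nd by auto
  qed
  have JK: "?J \<union> ?K = I" using cover ends_in by auto
  \<comment> \<open>Each set contains at most half of the star ends, rounded up; together they
    contain all of them and they share \<open>i\<close>. Hence all estimates are equalities and
    \<open>card I\<close> is odd.\<close>
  have sum: "?h U + ?h W = card I + card (?J \<inter> ?K)"
    using card_Un_Int[of ?J ?K] fin cJ cK JK by simp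
  have "i \<in> ?J \<inter> ?K" using ij W by auto
  then have ge1: "card (?J \<inter> ?K) \<ge> 1" using fin card_mono[of "?J \<inter> ?K" "{i}"] by simp
  have e1: "card (?J \<inter> ?K) = 1" "2 * ?h U = card I + 1" "2 * ?h W = card I + 1"
    using half[OF U(1)] half[OF W(1)] sum ge1 by linarith+
  then have "?J \<inter> ?K = {i}" using \<open>i \<in> ?J \<inter> ?K\<close> by (metis card_1_singletonE singletonD)
  have "c U = m + 1" "c W = m + 1"
    using dangerous_hits[OF U(1)] dangerous_hits[OF W(1)] e1 U(1) W(1) by (auto simp: dangerous_def)
  moreover have "card (?J - {i}) = card (?K - {i})" using e1 cJ cK ij W by simp
  moreover have "insert i (?J - {i}) = ?J" "insert i (?K - {i}) = ?K" using ij W by auto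
  moreover have "I = insert i ((?J - {i}) \<union> (?K - {i}))" using JK ij by blast
  moreover have "(?J - {i}) \<inter> (?K - {i}) = {}" using \<open>?J \<inter> ?K = {i}\<close> by blast
  ultimately have "exceptional i (?J - {i}) (?K - {i})"
    using U(1) W(1) cover by (intro exceptionalI[of _ _ _ U W]) (assumption | simp)+
  then show thesis using that by blast
qed

lemma exceptional_card:
  assumes "exceptional e P Q"
  shows "card I = 2 * card P + 1" "finite P" "finite Q"
proof -
  have "P \<subseteq> I" "Q \<subseteq> I" using assms by (auto elim: exceptionalE)
  then show f: "finite P" "finite Q" using fin finite_subset by blast+
  have "card (insert e (P \<union> Q)) = 2 * card P + 1"
    using f by (rule_tac exceptionalE[OF assms]) (simp add: card_Un_disjoint)
  then show "card I = 2 * card P + 1" by (rule_tac exceptionalE[OF assms]) (simp only:)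
qed

text \<open>\<open>U\<close> and \<open>W\<close> already attain the largest number of hits possible
  for a dangerous set, so by uncrossing a dangerous \<open>Z\<close> with both ends would cover
  \<open>A\<close> together with each of them. No edge of \<open>P\<close> or \<open>Q\<close> ends
  in \<open>U \<inter> W\<close>, so all of them end in \<open>Z\<close>. For \<open>card P\<close>
  at least 2, these \<open>2 * card P\<close> hits exceed the bound
  \<open>card P + 1\<close>.\<close>

lemma exceptional_not_dangerous:
  assumes ex: "exceptional e P Q" and p: "p \<in> P" and q: "q \<in> Q" and two: "card P \<ge> 2"
  shows "\<not> (\<exists>U. dangerous U \<and> a p \<in> U \<and> a q \<in> U)"
proof
  assume "\<exists>U. dangerous U \<and> a p \<in> U \<and> a q \<in> U"
  then obtain Z where Z: "dangerous Z" "a p \<in> Z" "a q \<in> Z" by blast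
  have half: "2 * hits I a B \<le> card I + 1" if "dangerous B" for B
    using dangerous_hits[OF that] that by (simp add: dangerous_def)
  have cov: "A \<subseteq> U \<union> Z"
    if ex: "exceptional e P Q" and p: "p \<in> P" "a p \<in> Z" and q: "q \<in> Q" "a q \<in> Z"
      and U: "dangerous U" "{i \<in> I. a i \<in> U} = insert e P" for p q P Q U
  proof (rule ccontr)
    assume nc: "\<not> A \<subseteq> U \<union> Z"
    note cI = exceptional_card[OF ex]
    have e: "e \<notin> P" "e \<notin> Q" "P \<inter> Q = {}" "I = insert e (P \<union> Q)" using ex by (auto simp: exceptional_def)
    have qU: "a q \<notin> U" and pU: "a p \<in> U" and pqI: "p \<in> I" "q \<in> I" using U(2) q p e by auto
    have hU: "hits I a U = card P + 1" unfolding hits_def U(2) using cI e by simp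
    have sub: "{i \<in> I. a i \<in> U} \<subset> {i \<in> I. a i \<in> U \<union> Z}" using q qU pqI by auto
    have "hits I a U < hits I a (U \<union> Z)"
      unfolding hits_def by (rule psubset_card_mono[OF _ sub]) (use fin in auto)
    then have nd: "\<not> dangerous (U \<union> Z)" using half[of "U \<union> Z"] cI hU by auto
    have "A \<inter> (U - Z) \<noteq> {}"
    proof
      assume "A \<inter> (U - Z) = {}"
      then have sub: "{i \<in> I. a i \<in> U} \<subset> {i \<in> I. a i \<in> Z}" using q qU pqI ends_in by auto
      have "hits I a U < hits I a Z"
        unfolding hits_def by (rule psubset_card_mono[OF _ sub]) (use fin in auto)
      then show False using half[OF Z(1)] hU cI by simp
    qed
    moreover have "A \<inter> (Z - U) \<noteq> {}" using q qU pqI ends_in by auto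
    ultimately show False using uncross[OF U(1) Z(1) nc pqI(1)] pU p nd by auto
  qed
  obtain U W where UW: "dangerous U" "dangerous W"
    "{i \<in> I. a i \<in> U} = insert e P" "{i \<in> I. a i \<in> W} = insert e Q"
    and e: "e \<notin> P" "e \<notin> Q" "P \<inter> Q = {}" "I = insert e (P \<union> Q)" "card P = card Q"
    using ex by (rule exceptionalE)
  have "A \<subseteq> U \<union> Z" "A \<subseteq> W \<union> Z"
    using cov[OF ex p Z(2) q Z(3) UW(1,3)] cov[OF exceptional_sym[OF ex] q Z(3) p Z(2) UW(2,4)] by auto
  moreover have "i \<in> I" "a i \<in> A" "a i \<notin> U \<or> a i \<notin> W" if "i \<in> P \<union> Q" for i
  proof -
    show "i \<in> I" using that e by blast
    then show "a i \<in> A" using ends_in by blast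
    have "i \<notin> insert e P \<or> i \<notin> insert e Q" using that e(1-3) by blast
    then show "a i \<notin> U \<or> a i \<notin> W" unfolding UW(3,4)[symmetric] using \<open>i \<in> I\<close> by blast
  qed
  ultimately have "P \<union> Q \<subseteq> {i \<in> I. a i \<in> Z}" by blast
  then have "card (P \<union> Q) \<le> hits I a Z" unfolding hits_def using fin by (intro card_mono) auto
  moreover have "card (P \<union> Q) = 2 * card P"
    using e exceptional_card(2,3)[OF ex] by (simp add: card_Un_disjoint)
  ultimately show False using half[OF Z(1)] exceptional_card[OF ex] two by simp
qed

lemma exceptional_lift:
  assumes ex: "exceptional e P Q" and p: "p \<in> P" and q: "q \<in> Q" and two: "card P \<ge> 2"
  shows "star A m (\<lambda>U. d U + sep (a p) (a q) U) (I - {p, q}) a"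
    "star.exceptional A m (\<lambda>U. d U + sep (a p) (a q) U) (I - {p, q}) a e (P - {p}) (Q - {q})"
proof -
  have pq: "p \<in> I" "q \<in> I" "p \<noteq> q" using ex p q by (auto simp: exceptional_def)
  show st: "star A m (\<lambda>U. d U + sep (a p) (a q) U) (I - {p, q}) a"
    by (rule not_dangerous_lift[OF pq exceptional_not_dangerous[OF assms]])
  interpret S: star A m "\<lambda>U. d U + sep (a p) (a q) U" "I - {p, q}" a by (rule st)
  obtain U W where UW: "dangerous U" "dangerous W" "A \<subseteq> U \<union> W" "c U = m + 1" "c W = m + 1"
    "{i \<in> I. a i \<in> U} = insert e P" "{i \<in> I. a i \<in> W} = insert e Q"
    and e: "e \<notin> P" "e \<notin> Q" "P \<inter> Q = {}" "I = insert e (P \<union> Q)" "card P = card Q"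
    using ex by (rule exceptionalE)
  have in_out: "a p \<in> U" "a q \<notin> U" "a p \<notin> W" "a q \<in> W" using UW(6,7) p q pq e by auto
  have "S.c U = m + 1" "S.c W = m + 1"
    using UW(4,5) in_out hits_remove2[OF fin pq, of a U] hits_remove2[OF fin pq, of a W] by (auto simp: sep_def)
  moreover from this have "S.dangerous U" "S.dangerous W"
    using UW(1,2) by (auto simp: S.dangerous_def dangerous_def)
  moreover have "{i \<in> I - {p, q}. a i \<in> U} = insert e (P - {p})"
    "{i \<in> I - {p, q}. a i \<in> W} = insert e (Q - {q})"
    using UW(6,7) e p q by auto
  moreover have "I - {p, q} = insert e ((P - {p}) \<union> (Q - {q}))" using e p q by auto
  moreover have "e \<notin> P - {p}" "e \<notin> Q - {q}" "(P - {p}) \<inter> (Q - {q}) = {}" using e by auto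
  moreover have "card (P - {p}) = card (Q - {q})" using e p q by simp
  ultimately show "S.exceptional e (P - {p}) (Q - {q})"
    using UW(3) by (intro S.exceptionalI[of _ _ _ U W])
qed

end

section \<open>Edge-disjoint equivalent rays\<close>

definition joins :: "'v set set \<Rightarrow> 'v \<Rightarrow> 'v \<Rightarrow> bool" where
  "joins D = (\<lambda>x y. {x, y} \<in> D)\<^sup>*\<^sup>*"

lemma joins_refl [simp]: "joins D x x"
  by (simp add: joins_def)

lemma joins_trans: "joins D x y \<Longrightarrow> joins D y z \<Longrightarrow> joins D x z"
  unfolding joins_def by (rule rtranclp_trans)

lemma joins_edge: "{x, y} \<in> D \<Longrightarrow> joins D x y"
  unfolding joins_def by blast

lemma joins_sym: "joins D x y \<Longrightarrow> joins D y x"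
  unfolding joins_def
  by (rule sympD[OF symp_rtranclp]) (auto simp: symp_def insert_commute)

lemma joins_mono: "joins D x y \<Longrightarrow> D \<subseteq> D' \<Longrightarrow> joins D' x y"
  unfolding joins_def by (erule rtranclp_mono[THEN predicate2D, rotated]) auto

lemma joins_induct [consumes 1, case_names refl step]:
  assumes "joins D x y" "P x"
    and "\<And>y z. joins D x y \<Longrightarrow> {y, z} \<in> D \<Longrightarrow> P y \<Longrightarrow> P z"
  shows "P y"
  using assms(1,2) unfolding joins_def
  by (induction rule: rtranclp_induct) (use assms(3) in \<open>auto simp: joins_def\<close>)

lemma joins_nonempty: "joins D x y \<Longrightarrow> x \<noteq> y \<Longrightarrow> D \<noteq> {}"
  by (induction rule: joins_induct) auto

lemma joins_finite:
  assumes "joins D x y"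
  obtains D' where "D' \<subseteq> D" "finite D'" "joins D' x y"
proof -
  have "\<exists>D'\<subseteq>D. finite D' \<and> joins D' x y"
    using assms
  proof (induction rule: joins_induct)
    case refl
    then show ?case by (intro exI[of _ "{}"]) simp
  next
    case (step y z)
    then obtain D' where "D' \<subseteq> D" "finite D'" "joins D' x y" by blast
    then show ?case using step(2)
      by (intro exI[of _ "insert {y, z} D'"])
        (auto intro: joins_trans[OF joins_mono joins_edge])
  qed
  then show thesis using that by blast
qed

lemma joins_within:
  assumes "joins D x y" "x \<in> C" "\<And>e. e \<in> D \<Longrightarrow> e \<inter> C \<noteq> {} \<Longrightarrow> e \<subseteq> C"
  shows "joins {e \<in> D. e \<subseteq> C} x y"
proof -
  have "y \<in> C \<and> joins {e \<in> D. e \<subseteq> C} x y"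
    using assms(1)
  proof (induction rule: joins_induct)
    case (step y z)
    then have "{y, z} \<subseteq> C" using assms(3)[of "{y, z}"] by auto
    then show ?case using step by (auto intro: joins_trans joins_edge)
  qed (use assms in auto)
  then show ?thesis by simp
qed

definition segment :: "(nat \<Rightarrow> 'v) \<Rightarrow> nat \<Rightarrow> nat \<Rightarrow> 'v set set" where
  "segment s l h = (\<lambda>n. {s n, s (Suc n)}) ` {l..<h}"

lemma finite_segment [simp]: "finite (segment s l h)"
  by (simp add: segment_def)

lemma segment_subset: "segment s l h \<subseteq> ray_edges s"
  by (auto simp: segment_def ray_edges_def)

lemma segment_empty [simp]: "segment s l l = {}"
  by (simp add: segment_def)

lemma joins_segment:
  assumes "l \<le> h"
  shows "joins (segment s l h) (s l) (s h)"
  using assms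
proof (induction h rule: dec_induct)
  case (step h)
  then have "joins (segment s l (Suc h)) (s l) (s h)"
    by (auto elim: joins_mono simp: segment_def)
  moreover have "{s h, s (Suc h)} \<in> segment s l (Suc h)" using step by (auto simp: segment_def)
  ultimately show ?case by (auto intro: joins_trans joins_edge)
qed simp

lemma segment_disjoint:
  assumes "inj s" "h \<le> l'"
  shows "segment s l h \<inter> segment s l' h' = {}"
proof -
  have "{s n, s (Suc n)} \<noteq> {s n', s (Suc n')}" if "n < h" "l' \<le> n'" for n n'
    using that assms by (auto simp: doubleton_eq_iff inj_eq)
  then show ?thesis unfolding segment_def by (intro equals0I) (elim IntE imageE, simp)
qed

text \<open>Equivalence of rays enters only as \<open>equiv\<close>: connections avoiding any
  prescribed finite vertex set. The clause \<open>r i m \<notin> Y\<close> is essential because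
  \<open>joins\<close> is reflexive and would otherwise accept a trivial connection at a vertex of
  \<open>Y\<close>.\<close>

locale ray_system =
  fixes E :: "'v set set" and A C :: "'v set" and I :: "'i set" and r :: "'i \<Rightarrow> nat \<Rightarrow> 'v"
  assumes edge: "e \<in> E \<Longrightarrow> \<exists>u v. e = {u, v}"
    and finA: "finite A" and AC: "A \<inter> C = {}"
    and closed: "e \<in> E \<Longrightarrow> e \<inter> C \<noteq> {} \<Longrightarrow> e \<subseteq> C \<union> A"
    and finI: "finite I"
    and start: "i \<in> I \<Longrightarrow> r i 0 \<in> A"
    and tail: "i \<in> I \<Longrightarrow> r i (Suc n) \<in> C"
    and ray_edge: "i \<in> I \<Longrightarrow> {r i n, r i (Suc n)} \<in> E"
    and inj: "i \<in> I \<Longrightarrow> inj (r i)"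
    and disj: "i \<in> I \<Longrightarrow> j \<in> I \<Longrightarrow> i \<noteq> j \<Longrightarrow> ray_edges (r i) \<inter> ray_edges (r j) = {}"
    and equiv: "i \<in> I \<Longrightarrow> j \<in> I \<Longrightarrow> finite Y \<Longrightarrow>
        \<exists>m n. r i m \<notin> Y \<and> joins {e \<in> E. e \<inter> Y = {}} (r i m) (r j n)"
begin

section \<open>The auxiliary graph on the rays\<close>

definition rays :: "'i set \<Rightarrow> 'v set set" where
  "rays J = (\<Union>l\<in>J. ray_edges (r l))"

definition EC :: "'v set set" where
  "EC = {e \<in> E. e \<inter> C \<noteq> {}}"

text \<open>The edges of all rays in \<open>J\<close> are excluded, those of \<open>i\<close> and
  \<open>j\<close> included. A connection thus shares no edge with the initial segments of these two
  rays that are later attached to it.\<close>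

definition adj :: "'i set \<Rightarrow> 'i \<Rightarrow> 'i \<Rightarrow> bool" where
  "adj J i j \<longleftrightarrow> (\<forall>Y. finite Y \<longrightarrow>
     (\<exists>m n. r i m \<notin> Y \<and> r j n \<notin> Y \<and> joins {e \<in> E. e \<inter> Y = {} \<and> e \<notin> rays J} (r i m) (r j n)))"

lemma adj_sym: "adj J i j \<Longrightarrow> adj J j i"
  unfolding adj_def by (blast intro: joins_sym)

lemma ray_edgesE:
  assumes "e \<in> ray_edges s" "x \<in> e"
  obtains n where "x = s n"
  using assms by (auto simp: ray_edges_def)

text \<open>Otherwise a finite set \<open>Y\<close> rules out all connections from \<open>J'\<close> to \<open>J - J'\<close>. A path that
  avoids \<open>Y\<close> and starts on a ray of \<open>J'\<close> then stays in the region reachable from those rays, since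
  the first edge of a ray of \<open>J - J'\<close> on it would complete such a connection.\<close>

lemma adj_connected:
  assumes J: "J \<subseteq> I" and J': "J' \<subset> J" "J' \<noteq> {}"
  shows "\<exists>i\<in>J'. \<exists>j\<in>J - J'. adj J i j"
proof (rule ccontr)
  assume "\<not> (\<exists>i\<in>J'. \<exists>j\<in>J - J'. adj J i j)"
  then have na: "\<not> adj J i j" if "i \<in> J'" "j \<in> J - J'" for i j using that by blast
  define bad where "bad i j Y \<longleftrightarrow> finite Y \<and> (\<forall>m n. r i m \<notin> Y \<longrightarrow> r j n \<notin> Y \<longrightarrow>
      \<not> joins {e \<in> E. e \<inter> Y = {} \<and> e \<notin> rays J} (r i m) (r j n))" for i j Y
  have "\<exists>Y. bad i j Y" if "i \<in> J'" "j \<in> J - J'" for i j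
    using na[OF that] unfolding adj_def bad_def by blast
  then obtain Y where bad: "\<And>i j. i \<in> J' \<Longrightarrow> j \<in> J - J' \<Longrightarrow> bad i j (Y i j)"
    by metis
  then have Y: "\<And>i j. i \<in> J' \<Longrightarrow> j \<in> J - J' \<Longrightarrow> finite (Y i j)"
    "\<And>i j m n. i \<in> J' \<Longrightarrow> j \<in> J - J' \<Longrightarrow> r i m \<notin> Y i j \<Longrightarrow> r j n \<notin> Y i j \<Longrightarrow>
      \<not> joins {e \<in> E. e \<inter> Y i j = {} \<and> e \<notin> rays J} (r i m) (r j n)"
    unfolding bad_def by blast+
  define Z where "Z = (\<Union>i\<in>J'. \<Union>j\<in>J - J'. Y i j)"
  let ?D = "{e \<in> E. e \<inter> Z = {} \<and> e \<notin> rays J}"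
  have finZ: "finite Z" unfolding Z_def
    using Y(1) J J' finI by (auto intro!: finite_UN_I dest: finite_subset)
  have YZ: "Y i j \<subseteq> Z" if "i \<in> J'" "j \<in> J - J'" for i j using that by (auto simp: Z_def)
  have sep: "\<not> joins ?D (r i m) (r j n)"
    if "i \<in> J'" "j \<in> J - J'" "r i m \<notin> Z" "r j n \<notin> Z" for i j m n
  proof
    assume "joins ?D (r i m) (r j n)"
    then have "joins {e \<in> E. e \<inter> Y i j = {} \<and> e \<notin> rays J} (r i m) (r j n)"
      by (rule joins_mono) (use YZ[OF that(1,2)] in blast)
    then show False using Y(2)[OF that(1,2)] that YZ[OF that(1,2)] by blast
  qed
  obtain i j where ij: "i \<in> J'" "j \<in> J - J'" using J' by blast
  then obtain m n where mn: "r i m \<notin> Z" "joins {e \<in> E. e \<inter> Z = {}} (r i m) (r j n)"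
    using equiv[of i j Z] finZ J J' by blast
  from mn(2) have "r j n \<notin> Z \<and> (\<exists>i\<in>J'. \<exists>m. r i m \<notin> Z \<and> joins ?D (r i m) (r j n))"
  proof (induction rule: joins_induct)
    case refl
    show ?case using mn(1) ij(1) by (intro conjI bexI[of _ i] exI[of _ m]) simp_all
  next
    case (step y z)
    then obtain i m where im: "i \<in> J'" "r i m \<notin> Z" "joins ?D (r i m) y" by blast
    have yz: "y \<notin> Z" "z \<notin> Z" using step by auto
    show ?case
    proof (cases "{y, z} \<in> rays J")
      case False
      then have "joins ?D (r i m) z" using im step(2) by (auto intro: joins_trans joins_edge)
      then show ?thesis using im yz by blast
    next
      case True
      then obtain l where l: "l \<in> J" "{y, z} \<in> ray_edges (r l)" by (auto simp: rays_def)
      then obtain s t where st: "y = r l s" "z = r l t" by (meson ray_edgesE insertI1 insertI2)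
      then have "l \<in> J'" using sep[OF im(1) _ im(2), of l s] im(3) yz l by auto
      \<comment> \<open>The vertex \<open>z\<close> lies on a ray of \<open>J'\<close> itself, so
        the walk outside \<open>rays J\<close> starts afresh at \<open>z\<close>.\<close>
      then show ?thesis using st yz by (intro conjI bexI[of _ l] exI[of _ t]) simp_all
    qed
  qed
  then show False using sep ij by blast
qed

text \<open>Adding the finite set \<open>A\<close> to the vertices to be avoided confines the
  connection to \<open>C\<close>.\<close>

lemma adj_path:
  assumes adj: "adj J i j" and i: "i \<in> I" and Y: "finite Y"
  obtains m n D where "finite D" "D \<subseteq> {e \<in> EC. e \<inter> Y = {}}" "D \<inter> rays J = {}"
    "joins D (r i m) (r j n)" "r i m \<in> C"
proof -
  let ?D = "{e \<in> E. e \<inter> (Y \<union> A) = {} \<and> e \<notin> rays J}"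
  obtain m n where mn: "r i m \<notin> Y \<union> A" "joins ?D (r i m) (r j n)"
    using adj[unfolded adj_def, rule_format, of "Y \<union> A"] Y finA by auto
  have "m \<noteq> 0" using mn start[OF i] by (cases m) auto
  then have "r i m \<in> C" using tail[OF i] by (cases m) auto
  then have "joins {e \<in> ?D. e \<subseteq> C} (r i m) (r j n)"
    using closed by (intro joins_within[OF mn(2)]) blast+
  then obtain D where D: "D \<subseteq> {e \<in> ?D. e \<subseteq> C}" "finite D" "joins D (r i m) (r j n)"
    by (rule joins_finite)
  have "e \<inter> C \<noteq> {}" if "e \<in> D" for e using that D edge[of e] by auto
  then show thesis using that[of D m n] D \<open>r i m \<in> C\<close> by (auto simp: EC_def)
qed

lemma ray_edges_EC: "i \<in> I \<Longrightarrow> ray_edges (r i) \<subseteq> EC"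
  using ray_edge tail by (fastforce simp: ray_edges_def EC_def)

lemma rays_disjoint: "i \<in> I \<Longrightarrow> J \<subseteq> I \<Longrightarrow> i \<notin> J \<Longrightarrow> ray_edges (r i) \<inter> rays J = {}"
  using disj by (fastforce simp: rays_def)

text \<open>\<open>adj\<close> offers only the avoidance of vertices, so used edges are avoided
  through their ends. This suffices since edges are nonempty.\<close>

lemma disjoint_if_Union_disjoint:
  assumes "D \<subseteq> {e \<in> EC. e \<inter> Y = {}}" "\<Union>S \<subseteq> Y"
  shows "D \<inter> S = {}"
  using assms edge unfolding EC_def by fastforce

lemma finite_Union_edges: "S \<subseteq> E \<Longrightarrow> finite S \<Longrightarrow> finite (\<Union>S)"
  using edge by (metis finite.emptyI finite.insertI finite_Union subsetD)

text \<open>The route follows ray \<open>i\<close>, crosses over by a connection that avoids the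
  ends of all edges in \<open>S\<close>, and returns along ray \<open>j\<close>. The other rays of
  \<open>J\<close> remain untouched for later steps.\<close>

lemma link:
  assumes adj: "adj J i j" and J: "J \<subseteq> I" and ij: "i \<in> J" "j \<in> J" "i \<noteq> j"
    and S: "finite S" "S \<subseteq> E" "S \<inter> rays J = {}"
  obtains D where "finite D" "D \<subseteq> EC" "D \<inter> S = {}" "D \<inter> rays (J - {i, j}) = {}"
    "joins D (r i 0) (r j 0)"
proof -
  have I: "i \<in> I" "j \<in> I" using J ij by auto
  obtain m n D where D: "finite D" "D \<subseteq> {e \<in> EC. e \<inter> \<Union>S = {}}" "D \<inter> rays J = {}"
    "joins D (r i m) (r j n)"
    using adj_path[OF adj I(1) finite_Union_edges[OF S(2,1)]] .
  let ?D = "segment (r i) 0 m \<union> D \<union> segment (r j) 0 n"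
  have seg: "segment (r i) 0 m \<subseteq> ray_edges (r i)" "segment (r j) 0 n \<subseteq> ray_edges (r j)"
    by (rule segment_subset)+
  have "joins ?D (r i 0) (r i m)" "joins ?D (r i m) (r j n)" "joins ?D (r j n) (r j 0)"
    using D(4) joins_segment[of 0 m "r i"] joins_sym[OF joins_segment[of 0 n "r j"]]
    by (auto elim: joins_mono)
  then have "joins ?D (r i 0) (r j 0)" by (blast intro: joins_trans)
  moreover have "?D \<subseteq> EC" using seg D(2) ray_edges_EC I by blast
  moreover have "ray_edges (r i) \<subseteq> rays J" "ray_edges (r j) \<subseteq> rays J" using ij by (auto simp: rays_def)
  then have "?D \<inter> S = {}" using seg S(3) disjoint_if_Union_disjoint[OF D(2) order_refl] by blast
  moreover have "rays (J - {i, j}) \<subseteq> rays J" by (auto simp: rays_def)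
  then have "?D \<inter> rays (J - {i, j}) = {}"
    using seg D(3) rays_disjoint[OF I(1), of "J - {i, j}"] rays_disjoint[OF I(2), of "J - {i, j}"] J by blast
  ultimately show thesis using that[of ?D] D(1) by simp
qed

text \<open>Two connections leave ray \<open>e\<close> at positions \<open>m\<close> and
  \<open>m'\<close>, the second avoiding all ends of edges of the first. The branch vertex is the
  earlier of the two positions; the stretch of ray \<open>e\<close> between them is given to the
  route that leaves later.\<close>

lemma claw:
  assumes adj: "adj J e p" "adj J e q" and J: "J \<subseteq> I"
    and epq: "e \<in> J" "p \<in> J" "q \<in> J" "e \<noteq> p" "e \<noteq> q" "p \<noteq> q"
    and S: "finite S" "S \<subseteq> E" "S \<inter> rays J = {}"
  obtains x D1 D2 D3 where "x \<in> C" "finite (D1 \<union> D2 \<union> D3)" "D1 \<union> D2 \<union> D3 \<subseteq> EC"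
    "D1 \<inter> D2 = {}" "D1 \<inter> D3 = {}" "D2 \<inter> D3 = {}"
    "(D1 \<union> D2 \<union> D3) \<inter> S = {}" "(D1 \<union> D2 \<union> D3) \<inter> rays (J - {e, p, q}) = {}"
    "joins D1 (r e 0) x" "joins D2 (r p 0) x" "joins D3 (r q 0) x"
proof -
  have I: "e \<in> I" "p \<in> I" "q \<in> I" using J epq by auto
  obtain m n B where B: "finite B" "B \<subseteq> {e \<in> EC. e \<inter> \<Union>S = {}}" "B \<inter> rays J = {}"
    "joins B (r e m) (r p n)" "r e m \<in> C"
    using adj_path[OF adj(1) I(1) finite_Union_edges[OF S(2,1)]] .
  have SB: "S \<union> B \<subseteq> E" "finite (S \<union> B)" using S B by (auto simp: EC_def)
  obtain m' n' B' where B': "finite B'" "B' \<subseteq> {e \<in> EC. e \<inter> \<Union>(S \<union> B) = {}}" "B' \<inter> rays J = {}"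
    "joins B' (r e m') (r q n')" "r e m' \<in> C"
    using adj_path[OF adj(2) I(1) finite_Union_edges[OF SB]] .
  define k where "k = min m m'"
  have seg: "segment (r l) s t \<subseteq> ray_edges (r l)" for l s t by (rule segment_subset)
  have rJ: "ray_edges (r e) \<subseteq> rays J" "ray_edges (r p) \<subseteq> rays J" "ray_edges (r q) \<subseteq> rays J"
    using epq by (auto simp: rays_def)
  have dis: "B \<inter> S = {}" "B' \<inter> (S \<union> B) = {}"
    using disjoint_if_Union_disjoint[OF B(2) order_refl] disjoint_if_Union_disjoint[OF B'(2) order_refl] .
  have segk: "segment (r e) 0 k \<inter> segment (r e) k m = {}" "segment (r e) 0 k \<inter> segment (r e) k m' = {}"
    by (rule segment_disjoint[OF inj[OF I(1)] order_refl])+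
  \<comment> \<open>One of the two segments is empty, since \<open>k\<close> is \<open>m\<close> or
    \<open>m'\<close>.\<close>
  have segk': "segment (r e) k m \<inter> segment (r e) k m' = {}" by (auto simp: k_def min_def)
  have rr: "ray_edges (r e) \<inter> ray_edges (r p) = {}" "ray_edges (r e) \<inter> ray_edges (r q) = {}"
    "ray_edges (r p) \<inter> ray_edges (r q) = {}" using disj I epq by auto
  let ?D1 = "segment (r e) 0 k"
  let ?D2 = "segment (r p) 0 n \<union> B \<union> segment (r e) k m"
  let ?D3 = "segment (r q) 0 n' \<union> B' \<union> segment (r e) k m'"
  show thesis
  proof (rule that)
    show "r e k \<in> C" using B B' by (simp add: k_def min_def)
    show "finite (?D1 \<union> ?D2 \<union> ?D3)" using B B' by simp
    show "?D1 \<union> ?D2 \<union> ?D3 \<subseteq> EC" using B(2) B'(2) seg I[THEN ray_edges_EC] by blast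
    show "?D1 \<inter> ?D2 = {}" using seg[of e] seg[of p] rJ B(3) segk rr by blast
    show "?D1 \<inter> ?D3 = {}" using seg[of e] seg[of q] rJ B'(3) segk rr by blast
    have "segment (r p) 0 n \<inter> ?D3 = {}" using seg[of p] seg[of q] seg[of e] rr rJ B'(3) by blast
    moreover have "segment (r e) k m \<inter> ?D3 = {}" using seg[of q] seg[of e] rr rJ B'(3) segk' by blast
    moreover have "B \<inter> ?D3 = {}" using seg[of q] seg[of e] rJ B(3) dis by blast
    ultimately show "?D2 \<inter> ?D3 = {}" by blast
    have "segment (r e) s t \<inter> S = {}" "segment (r p) s t \<inter> S = {}" "segment (r q) s t \<inter> S = {}" for s t
      using seg rJ S(3) by blast+
    then show "(?D1 \<union> ?D2 \<union> ?D3) \<inter> S = {}" using dis by blast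
    have "ray_edges (r l) \<inter> rays (J - {e, p, q}) = {}" if "l \<in> {e, p, q}" for l
      using that I J by (intro rays_disjoint) auto
    then have "segment (r l) s t \<inter> rays (J - {e, p, q}) = {}" if "l \<in> {e, p, q}" for l s t
      using seg that by blast
    moreover have "rays (J - {e, p, q}) \<subseteq> rays J" by (auto simp: rays_def)
    ultimately show "(?D1 \<union> ?D2 \<union> ?D3) \<inter> rays (J - {e, p, q}) = {}"
      using B(3) B'(3) by (simp add: Int_Un_distrib2) blast
    show "joins ?D1 (r e 0) (r e k)" by (rule joins_segment) simp
    have 2: "joins ?D2 (r p 0) (r p n)" "joins ?D2 (r p n) (r e m)" "joins ?D2 (r e m) (r e k)"
      using joins_segment[of 0 n "r p"] joins_sym[OF B(4)] joins_sym[OF joins_segment[of k m "r e"]]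
      by (auto elim: joins_mono simp: k_def)
    show "joins ?D2 (r p 0) (r e k)" using joins_trans[OF joins_trans[OF 2(1,2)] 2(3)] .
    have 3: "joins ?D3 (r q 0) (r q n')" "joins ?D3 (r q n') (r e m')" "joins ?D3 (r e m') (r e k)"
      using joins_segment[of 0 n' "r q"] joins_sym[OF B'(4)] joins_sym[OF joins_segment[of k m' "r e"]]
      by (auto elim: joins_mono simp: k_def)
    show "joins ?D3 (r q 0) (r e k)" using joins_trans[OF joins_trans[OF 3(1,2)] 3(3)] .
  qed
qed

end

section \<open>Resolving a contracted component\<close>

definition crossing :: "('l \<times> 'v \<times> 'v) set \<Rightarrow> 'v set \<Rightarrow> ('l \<times> 'v \<times> 'v) set" where
  "crossing K U = {p \<in> K. (fst (snd p) \<in> U) \<noteq> (snd (snd p) \<in> U)}"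

definition cut_size :: "('l \<times> 'v \<times> 'v) set \<Rightarrow> 'v set \<Rightarrow> nat" where
  "cut_size K U = card (crossing K U)"

text \<open>A label tells parallel edges apart and at the same time reserves the edges of
  \<open>G\<close> through which its edge is routed. Disjoint labels therefore yield edge-disjoint
  paths.\<close>

definition disjoint_labels :: "('e set \<times> 'v \<times> 'v) set \<Rightarrow> bool" where
  "disjoint_labels K \<longleftrightarrow> (\<forall>p\<in>K. \<forall>q\<in>K. p \<noteq> q \<longrightarrow> fst p \<inter> fst q = {})"

lemma finite_crossing [simp]: "finite K \<Longrightarrow> finite (crossing K U)"
  by (simp add: crossing_def)

lemma cut_size_insert:
  assumes "finite K" "(D, u, v) \<notin> K"
  shows "cut_size (insert (D, u, v) K) U = sep u v U + cut_size K U"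
proof -
  have "crossing (insert (D, u, v) K) U =
      (if (u \<in> U) \<noteq> (v \<in> U) then insert (D, u, v) (crossing K U) else crossing K U)"
    by (auto simp: crossing_def)
  moreover have "(D, u, v) \<notin> crossing K U" using assms(2) by (simp add: crossing_def)
  ultimately show ?thesis using assms(1) by (simp add: cut_size_def sep_def)
qed

lemma cut_size_empty [simp]: "cut_size {} U = 0"
  by (simp add: cut_size_def crossing_def)

lemma cut_size_Un:
  assumes "finite K" "finite L" "K \<inter> L = {}"
  shows "cut_size (K \<union> L) U = cut_size K U + cut_size L U"
proof -
  have "crossing (K \<union> L) U = crossing K U \<union> crossing L U" "crossing K U \<inter> crossing L U = {}"
    using assms(3) by (auto simp: crossing_def)
  then show ?thesis using assms(1,2) by (simp add: cut_size_def card_Un_disjoint)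
qed

lemma cut_size_Compl: "cut_size K (- U) = cut_size K U"
proof -
  have "crossing K (- U) = crossing K U" by (auto simp: crossing_def)
  then show ?thesis by (simp add: cut_size_def)
qed

lemma cut_function_cut_size: "finite K \<Longrightarrow> cut_function (cut_size K)"
proof (induction K rule: finite_induct)
  case empty
  then show ?case by (simp add: cut_function_def)
next
  case (insert p K)
  obtain D u v where p: "p = (D, u, v)" by (cases p)
  have "cut_size (insert p K) = (\<lambda>U. sep u v U + cut_size K U)"
    using cut_size_insert[of K D u v] insert(1,2) p by (simp add: fun_eq_iff)
  then show ?case using cut_function_add[OF cut_function_sep insert.IH] by simp
qed

context ray_system
begin

section \<open>Replacing the star of a contracted component\<close>

abbreviation "a \<equiv> \<lambda>i. r i 0"

text \<open>\<open>K\<close> replaces the star of the contracted set \<open>C\<close>: an element \<open>(D, u, v)\<close> is an edge \<open>uv\<close> to be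
  routed in the edge set \<open>D\<close>, which must avoid the edges \<open>S\<close> already in use, and \<open>X\<close> contains the new
  vertex of degree 3, if there is one.\<close>

definition linking_edge :: "'v set set \<Rightarrow> 'v set \<Rightarrow> ('v set set \<times> 'v \<times> 'v) \<Rightarrow> bool" where
  "linking_edge S X = (\<lambda>(D, u, v). finite D \<and> D \<subseteq> EC \<and> D \<inter> S = {} \<and> u \<in> A \<and> v \<in> A \<union> X \<and> u \<noteq> v \<and> joins D u v)"

definition resolves :: "'v set set \<Rightarrow> 'v set \<Rightarrow> ('v set set \<times> 'v \<times> 'v) set \<Rightarrow> bool" where
  "resolves S X K \<longleftrightarrow> finite K \<and> disjoint_labels K \<and> (\<forall>p\<in>K. linking_edge S X p) \<and>
     X \<subseteq> C \<and> finite X \<and> card X \<le> 1 \<and> (\<forall>x\<in>X. card {p \<in> K. snd (snd p) = x} = 3)"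

lemma linking_edge_Un:
  "linking_edge (S \<union> S') X p \<longleftrightarrow> linking_edge S X p \<and> fst p \<inter> S' = {}"
  by (cases p) (auto simp: linking_edge_def)

text \<open>This realizes a lifted pair: \<open>K\<close> resolves the star that is left after the
  lift while \<open>D\<close> is reserved, and then \<open>D\<close> becomes the label of the lifted
  edge.\<close>

lemma resolves_insert:
  assumes K: "resolves (S \<union> D) X K" and D: "finite D" "D \<subseteq> EC" "D \<inter> S = {}" "joins D u v"
    and uv: "u \<in> A" "v \<in> A"
  obtains K' where "resolves S X K'" "\<And>U. cut_size K' U = sep u v U + cut_size K U"
proof -
  have K': "resolves S X K" and dis: "\<And>p. p \<in> K \<Longrightarrow> fst p \<inter> D = {}"
    using K by (auto simp: resolves_def linking_edge_Un)
  show thesis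
  proof (cases "u = v")
    \<comment> \<open>The two rays start at the same vertex of \<open>A\<close>: the lifted edge is
      a loop, crosses no cut and is dropped.\<close>
    case True
    then show thesis using that[OF K'] by (simp add: sep_def)
  next
    case False
    then have ne: "D \<noteq> {}" using joins_nonempty[OF D(4)] by simp
    have X: "v \<notin> X" using K AC uv by (auto simp: resolves_def)
    have new: "(D, u, v) \<notin> K" using dis[of "(D, u, v)"] ne by auto
    have "{p \<in> insert (D, u, v) K. snd (snd p) = x} = {p \<in> K. snd (snd p) = x}" if "x \<in> X" for x
      using X that by auto
    moreover have "disjoint_labels (insert (D, u, v) K)"
      using K' dis unfolding disjoint_labels_def resolves_def by (simp add: Int_commute)
    moreover have "linking_edge S X (D, u, v)" using D uv False by (simp add: linking_edge_def)
    ultimately have "resolves S X (insert (D, u, v) K)"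
      using K' unfolding resolves_def by simp
    moreover have "cut_size (insert (D, u, v) K) U = sep u v U + cut_size K U" for U
      using K' new by (auto simp: resolves_def intro: cut_size_insert)
    ultimately show thesis using that by blast
  qed
qed

text \<open>Complementing \<open>U\<close> exchanges the two possible placements of the new vertex.\<close>

lemma resolves_claw:
  assumes K: "resolves (S \<union> (D1 \<union> D2 \<union> D3)) {} K"
    and D: "finite (D1 \<union> D2 \<union> D3)" "D1 \<union> D2 \<union> D3 \<subseteq> EC" "(D1 \<union> D2 \<union> D3) \<inter> S = {}"
      "D1 \<inter> D2 = {}" "D1 \<inter> D3 = {}" "D2 \<inter> D3 = {}"
    and j: "joins D1 (a e) x" "joins D2 (a p) x" "joins D3 (a q) x"
    and x: "x \<in> C" and epq: "e \<in> I" "p \<in> I" "q \<in> I" "e \<noteq> p" "e \<noteq> q" "p \<noteq> q"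
    and d: "cut_function d"
    and m: "\<And>U. splits A U \<Longrightarrow> m \<le> d U + hits {e, p, q} a U + cut_size K U"
  shows "\<exists>K'. resolves S {x} K' \<and> (\<forall>U. splits A U \<longrightarrow> m \<le> d U + cut_size K' U)"
proof -
  have aA: "a e \<in> A" "a p \<in> A" "a q \<in> A" using start epq by auto
  then have ax: "a e \<noteq> x" "a p \<noteq> x" "a q \<noteq> x" using AC x by auto
  have ne: "D1 \<noteq> {}" "D2 \<noteq> {}" "D3 \<noteq> {}" using j[THEN joins_nonempty] ax by simp_all
  let ?L = "{(D1, a e, x), (D2, a p, x), (D3, a q, x)}"
  have finK: "finite K" using K by (simp add: resolves_def)
  have KA: "snd (snd p) \<in> A" "fst p \<inter> (D1 \<union> D2 \<union> D3) = {}" if "p \<in> K" for p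
    using K that by (auto simp: resolves_def linking_edge_Un) (auto simp: linking_edge_def)
  have D123: "D1 \<noteq> D2" "D1 \<noteq> D3" "D2 \<noteq> D3" using D ne by auto
  have xA: "x \<notin> A" using x AC by auto
  have "p \<notin> K" if "snd (snd p) = x" for p using KA(1)[of p] xA that by auto
  then have KL: "?L \<inter> K = {}" and K_x: "{p \<in> K. snd (snd p) = x} = {}" by auto
  have "{p \<in> ?L \<union> K. snd (snd p) = x} = ?L \<union> {p \<in> K. snd (snd p) = x}" by auto
  then have "{p \<in> ?L \<union> K. snd (snd p) = x} = ?L" using K_x by simp
  then have "card {p \<in> ?L \<union> K. snd (snd p) = x} = 3" using D123 by simp
  moreover have "disjoint_labels (?L \<union> K)"
  proof -
    have LL: "fst p \<inter> fst q = {}" if "p \<in> ?L" "q \<in> ?L" "p \<noteq> q" for p q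
      using that D(4-6) by (elim insertE) (simp_all add: Int_commute)
    have LK: "fst p \<inter> fst q = {}" if "p \<in> ?L" "q \<in> K" for p q
      using that(1) KA(2)[OF that(2)] by (elim insertE) auto
    have "disjoint_labels K" using K by (simp add: resolves_def)
    then have KK: "fst p \<inter> fst q = {}" if "p \<in> K" "q \<in> K" "p \<noteq> q" for p q
      using that unfolding disjoint_labels_def by blast
    have "fst p \<inter> fst q = {}" if pq: "p \<in> ?L \<union> K" "q \<in> ?L \<union> K" "p \<noteq> q" for p q
      using pq(1)
    proof
      assume p: "p \<in> ?L"
      from pq(2) show ?thesis using LL[OF p _ pq(3)] LK[OF p] by (rule UnE)
    next
      assume p: "p \<in> K"
      from pq(2) show ?thesis using KK[OF p _ pq(3)] LK[OF _ p] Int_commute by (elim UnE) blast+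
    qed
    then show ?thesis unfolding disjoint_labels_def by blast
  qed
  moreover have "\<forall>p\<in>?L. linking_edge S {x} p"
    using D j ax aA by (simp add: linking_edge_def Int_Un_distrib2)
  moreover have "linking_edge S {x} p" if "p \<in> K" for p
    using K that by (cases p) (auto simp: resolves_def linking_edge_def)
  ultimately have "resolves S {x} (?L \<union> K)"
    using finK x unfolding resolves_def by (simp add: ball_Un)
  moreover have "m \<le> d U + cut_size (?L \<union> K) U" if U: "splits A U" for U
  proof -
    have "cut_size (?L \<union> K) U = cut_size ?L U + cut_size K U" using finK KL by (intro cut_size_Un) auto
    moreover have "cut_size ?L U = sep (a e) x U + sep (a p) x U + sep (a q) x U"
      using D123 cut_size_insert[of "{(D2, a p, x), (D3, a q, x)}" D1 "a e" x U]
        cut_size_insert[of "{(D3, a q, x)}" D2 "a p" x U] cut_size_insert[of "{}" D3 "a q" x U] by simp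
    moreover have "hits {e, p, q} a W = of_bool (a e \<in> W) + of_bool (a p \<in> W) + of_bool (a q \<in> W)" for W
      using epq hits_insert[of "{p, q}" e a W] hits_insert[of "{q}" p a W] hits_insert[of "{}" q a W]
      by (simp add: hits_def)
    moreover have "d (- U) = d U" using d by (rule cut_function_Compl)
    ultimately show ?thesis using m[OF U] m[of "- U"] U
      by (cases "x \<in> U") (auto simp: sep_def cut_size_Compl)
  qed
  ultimately show ?thesis by blast
qed

lemma rays_mono: "J \<subseteq> J' \<Longrightarrow> rays J \<subseteq> rays J'"
  by (auto simp: rays_def)

text \<open>The rays \<open>e\<close>, \<open>p'\<close>, \<open>q'\<close> are spent on the claw,
  whose edges will be part of \<open>S\<close>, so the auxiliary graph is taken on the rays of
  \<open>P - {p'}\<close> and \<open>Q - {q'}\<close> alone. Its connectedness gives an edge between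
  these two sets, and every such pair can be lifted with the structure preserved. The star still
  contains \<open>e\<close>, \<open>p'\<close>, \<open>q'\<close>; they are all that is left when
  \<open>card P = 1\<close>.\<close>

lemma match_exceptional:
  assumes "star A m d J a" "star.exceptional A m d J a e P Q" "J \<subseteq> I" "p' \<in> P" "q' \<in> Q"
    "finite S" "S \<subseteq> E" "S \<inter> rays ((P - {p'}) \<union> (Q - {q'})) = {}"
  shows "\<exists>K. resolves S {} K \<and> (\<forall>U. splits A U \<longrightarrow> m \<le> d U + hits {e, p', q'} a U + cut_size K U)"
  using assms
proof (induction "card P" arbitrary: d J P Q S rule: less_induct)
  case less
  interpret star A m d J a by (rule less.prems(1))
  note ex = less.prems(2)
  note card = exceptional_card[OF ex]
  obtain "J = insert e (P \<union> Q)" "e \<notin> P" "e \<notin> Q" "P \<inter> Q = {}" "card P = card Q"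
    using exceptionalE[OF ex] .
  note e = this
  show ?case
  proof (cases "card P = 1")
    case True
    then have "P = {p'}" "Q = {q'}" using less.prems(4,5) e(5) by (auto simp: card_1_singleton_iff)
    then have "m \<le> d U + hits {e, p', q'} a U + cut_size {} U" if "splits A U" for U
      using ok[OF that] e(1) by (simp add: insert_commute)
    moreover have "resolves S {} {}" by (simp add: resolves_def disjoint_labels_def)
    ultimately show ?thesis by blast
  next
    case False
    have "card P \<noteq> 0" using less.prems(4) card by auto
    with False have two: "card P \<ge> 2" by simp
    let ?J = "(P - {p'}) \<union> (Q - {q'})"
    have "card (P - {p'}) \<ge> 1" "card (Q - {q'}) \<ge> 1" using two card less.prems(4,5) e(5) by simp_all
    then have ne: "P - {p'} \<noteq> {}" "Q - {q'} \<noteq> {}" by force+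
    have JI: "?J \<subseteq> I" using less.prems(3) e(1) by blast
    have "P - {p'} \<subset> ?J" using ne e(4) by blast
    then obtain p q where pq: "p \<in> P - {p'}" "q \<in> ?J - (P - {p'})" "adj ?J p q"
      using adj_connected[OF JI _ ne(1)] by blast
    then have q: "q \<in> Q - {q'}" "p \<noteq> q" using e by auto
    have pqI: "p \<in> I" "q \<in> I" using JI pq q by auto
    obtain D where D: "finite D" "D \<subseteq> EC" "D \<inter> S = {}" "D \<inter> rays (?J - {p, q}) = {}"
      "joins D (a p) (a q)"
      using link[OF pq(3) JI _ _ q(2) less.prems(6,7,8)] pq(1) q(1) by blast
    let ?d = "\<lambda>U. d U + sep (a p) (a q) U"
    have "(P - {p} - {p'}) \<union> (Q - {q} - {q'}) \<subseteq> ?J - {p, q}" using e(4) pq q by blast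
    then have sub: "rays ((P - {p} - {p'}) \<union> (Q - {q} - {q'})) \<subseteq> rays (?J - {p, q})"
      "rays ((P - {p} - {p'}) \<union> (Q - {q} - {q'})) \<subseteq> rays ?J"
      by (auto intro!: rays_mono)
    have "\<exists>K. resolves (S \<union> D) {} K \<and>
        (\<forall>U. splits A U \<longrightarrow> m \<le> ?d U + hits {e, p', q'} a U + cut_size K U)"
    proof (rule less.hyps)
      show "card (P - {p}) < card P" using card(2) pq(1) by (intro card_Diff1_less) auto
      show "star A m ?d (J - {p, q}) a" "star.exceptional A m ?d (J - {p, q}) a e (P - {p}) (Q - {q})"
        using exceptional_lift[OF ex _ _ two] pq q by blast+
      show "(S \<union> D) \<inter> rays ((P - {p} - {p'}) \<union> (Q - {q} - {q'})) = {}"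
        using sub D(4) less.prems(8) by blast
      show "S \<union> D \<subseteq> E" using D(2) less.prems(7) by (auto simp: EC_def)
    qed (use less.prems D pq q in auto)
    then obtain K where K: "resolves (S \<union> D) {} K"
      "\<And>U. splits A U \<Longrightarrow> m \<le> ?d U + hits {e, p', q'} a U + cut_size K U" by blast
    obtain K' where K': "resolves S {} K'" "\<And>U. cut_size K' U = sep (a p) (a q) U + cut_size K U"
      using resolves_insert[OF K(1) D(1,2,3,5)] start pqI by blast
    have "m \<le> d U + hits {e, p', q'} a U + cut_size K' U" if "splits A U" for U
      using K(2)[OF that] K'(2)[of U] by simp
    then show ?thesis using K' by blast
  qed
qed

text \<open>A connected graph on three vertices contains a path through all of them;
  \<open>e\<close> is its middle vertex.\<close>

lemma adj_center:
  assumes J: "J \<subseteq> I" "card J = 3"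
  obtains e p q where "J = {e, p, q}" "e \<noteq> p" "e \<noteq> q" "p \<noteq> q" "adj J e p" "adj J e q"
proof -
  have "J \<noteq> {}" using J(2) by auto
  then obtain i where i: "i \<in> J" by blast
  have "J \<noteq> {i}" using J(2) by auto
  then have "{i} \<subset> J" using i by blast
  then obtain j where j: "j \<in> J" "j \<noteq> i" "adj J i j" using adj_connected[OF J(1), of "{i}"] by blast
  have "{i, j} \<noteq> J" using J(2) j by auto
  then have "{i, j} \<subset> J" using i j by blast
  then obtain l k where l: "l \<in> J" "l \<notin> {i, j}" "k \<in> {i, j}" "adj J k l"
    using adj_connected[OF J(1), of "{i, j}"] by blast
  have fin: "finite J" using J(2) by (simp add: card_ge_0_finite)
  have "card {i, j, l} = 3" using j l by auto
  then have Jeq: "J = {i, j, l}" using card_subset_eq[OF fin, of "{i, j, l}"] i j l J(2) by auto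
  show thesis
  proof (cases "k = i")
    case True
    then show thesis using that[of i j l] Jeq j l by auto
  next
    case False
    then have "k = j" using l by blast
    moreover have "J = {j, i, l}" using Jeq by auto
    ultimately show thesis using that[of j i l] j l adj_sym[OF j(3)] by auto
  qed
qed

text \<open>The induction lowers \<open>card J\<close> by 2 and keeps a star of three edges as a
  claw, so it never reaches a single edge. In the exceptional case \<open>card J\<close> is at least
  5. There every pair in \<open>P \<times> Q\<close> is liftable while no auxiliary edge is, so an
  auxiliary edge leaving \<open>P\<close> or \<open>Q\<close> must lead to \<open>e\<close>; this
  yields \<open>p\<close> and \<open>q\<close>.\<close>

lemma resolve_star:
  assumes "star A m d J a" "J \<subseteq> I" "card J \<noteq> 1" "finite S" "S \<subseteq> E" "S \<inter> rays J = {}"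
  shows "\<exists>K X. resolves S X K \<and> (\<forall>U. splits A U \<longrightarrow> m \<le> d U + cut_size K U)"
  using assms
proof (induction "card J" arbitrary: d J S rule: less_induct)
  case less
  interpret star A m d J a by (rule less.prems(1))
  note S = less.prems(4-6) and JI = less.prems(2)
  show ?case
  proof (cases "J = {} \<or> card J = 3")
    case True
    then show ?thesis
    proof
      assume "J = {}"
      then have "m \<le> d U + cut_size {} U" if "splits A U" for U
        using ok[OF that] by (simp add: hits_def)
      moreover have "resolves S {} {}" by (simp add: resolves_def disjoint_labels_def)
      ultimately show ?thesis by blast
    next
      assume "card J = 3"
      then obtain e p q where J: "J = {e, p, q}" "e \<noteq> p" "e \<noteq> q" "p \<noteq> q" "adj J e p" "adj J e q"
        using adj_center[OF JI] by blast
      obtain x D1 D2 D3 where D: "x \<in> C" "finite (D1 \<union> D2 \<union> D3)" "D1 \<union> D2 \<union> D3 \<subseteq> EC"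
        "D1 \<inter> D2 = {}" "D1 \<inter> D3 = {}" "D2 \<inter> D3 = {}"
        "(D1 \<union> D2 \<union> D3) \<inter> S = {}" "(D1 \<union> D2 \<union> D3) \<inter> rays (J - {e, p, q}) = {}"
        "joins D1 (a e) x" "joins D2 (a p) x" "joins D3 (a q) x"
        by (rule claw[OF J(5,6) JI _ _ _ J(2-4) S]) (use J(1) in auto)
      have "resolves (S \<union> (D1 \<union> D2 \<union> D3)) {} {}" by (simp add: resolves_def disjoint_labels_def)
      moreover have "m \<le> d U + hits {e, p, q} a U + cut_size {} U" if "splits A U" for U
        using ok[OF that] J(1) by simp
      moreover have "e \<in> I" "p \<in> I" "q \<in> I" using JI J(1) by auto
      ultimately have "\<exists>K'. resolves S {x} K' \<and> (\<forall>U. splits A U \<longrightarrow> m \<le> d U + cut_size K' U)"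
        by (intro resolves_claw[OF _ D(2,3,7,4-6,9-11,1) _ _ _ J(2-4) cutf])
      then show ?thesis by blast
    qed
  next
    case False
    then have "card J \<noteq> 0" using fin by auto
    then have two: "card J \<ge> 2" using less.prems(3) by linarith
    show ?thesis
    proof (cases "\<exists>i\<in>J. \<exists>j\<in>J. i \<noteq> j \<and> adj J i j \<and> \<not> (\<exists>U. dangerous U \<and> a i \<in> U \<and> a j \<in> U)")
      case True
      then obtain i j where ij: "i \<in> J" "j \<in> J" "i \<noteq> j" "adj J i j"
        "\<not> (\<exists>U. dangerous U \<and> a i \<in> U \<and> a j \<in> U)" by blast
      obtain D where D: "finite D" "D \<subseteq> EC" "D \<inter> S = {}" "D \<inter> rays (J - {i, j}) = {}"
        "joins D (a i) (a j)"
        using link[OF ij(4) JI ij(1-3) S] .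
      let ?d = "\<lambda>U. d U + sep (a i) (a j) U"
      have card2: "card (J - {i, j}) = card J - 2" using ij fin by (simp add: card_Diff_subset)
      have "\<exists>K X. resolves (S \<union> D) X K \<and> (\<forall>U. splits A U \<longrightarrow> m \<le> ?d U + cut_size K U)"
      proof (rule less.hyps)
        show "card (J - {i, j}) < card J" "card (J - {i, j}) \<noteq> 1" using card2 two False by auto
        show "star A m ?d (J - {i, j}) a" by (rule not_dangerous_lift[OF ij(1-3,5)])
        show "S \<union> D \<subseteq> E" using D(2) S(2) by (auto simp: EC_def)
        show "(S \<union> D) \<inter> rays (J - {i, j}) = {}" using D(4) S(3) by (auto simp: rays_def)
      qed (use D S JI in auto)
      then obtain K X where K: "resolves (S \<union> D) X K"
        "\<And>U. splits A U \<Longrightarrow> m \<le> ?d U + cut_size K U" by blast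
      have "a i \<in> A" "a j \<in> A" using ij ends_in by auto
      then obtain K' where K': "resolves S X K'" "\<And>U. cut_size K' U = sep (a i) (a j) U + cut_size K U"
        using resolves_insert[OF K(1) D(1,2,3,5)] by blast
      have "m \<le> d U + cut_size K' U" if "splits A U" for U
        using K(2)[OF that] K'(2)[of U] by simp
      then show ?thesis using K' by blast
    next
      case nolift: False
      obtain e P Q where ex: "exceptional e P Q"
        by (rule exceptional_if_no_lift[of "adj J"]) (use adj_connected[OF JI] nolift two in blast)+
      obtain J: "J = insert e (P \<union> Q)" "e \<notin> P" "e \<notin> Q" "P \<inter> Q = {}" "card P = card Q"
        using exceptionalE[OF ex] .
      note card = exceptional_card[OF ex]
      have "card P \<noteq> 0" "card P \<noteq> 1" using card(1) two False by auto
      then have twoP: "card P \<ge> 2" by linarith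
      have nbr: "\<exists>p\<in>P. adj J e p"
        if ex: "exceptional e P Q" and two: "card P \<ge> 2" for P Q
      proof -
        obtain J: "J = insert e (P \<union> Q)" "e \<notin> P" "e \<notin> Q" "P \<inter> Q = {}" "card P = card Q"
          using exceptionalE[OF ex] .
        have "P \<noteq> {}" using two by auto
        then obtain p q where pq: "p \<in> P" "q \<in> J - P" "adj J p q"
          using adj_connected[OF JI, of P] J by blast
        have "q \<notin> Q"
        proof
          assume q: "q \<in> Q"
          then have "p \<in> J" "q \<in> J" "p \<noteq> q" using pq J by auto
          then show False using nolift pq(3) exceptional_not_dangerous[OF ex pq(1) q two] by blast
        qed
        then have "q = e" using pq(2) J(1) by blast
        then show ?thesis using pq adj_sym by blast
      qed
      obtain p q where pq: "p \<in> P" "adj J e p" "q \<in> Q" "adj J e q"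
        using nbr[OF ex twoP] nbr[OF exceptional_sym[OF ex]] twoP J(5) by auto
      have neq: "e \<noteq> p" "e \<noteq> q" "p \<noteq> q" and inJ: "e \<in> J" "p \<in> J" "q \<in> J" using pq J by auto
      obtain x D1 D2 D3 where D: "x \<in> C" "finite (D1 \<union> D2 \<union> D3)" "D1 \<union> D2 \<union> D3 \<subseteq> EC"
        "D1 \<inter> D2 = {}" "D1 \<inter> D3 = {}" "D2 \<inter> D3 = {}"
        "(D1 \<union> D2 \<union> D3) \<inter> S = {}" "(D1 \<union> D2 \<union> D3) \<inter> rays (J - {e, p, q}) = {}"
        "joins D1 (a e) x" "joins D2 (a p) x" "joins D3 (a q) x"
        by (rule claw[OF pq(2,4) JI inJ neq S])
      have "(P - {p}) \<union> (Q - {q}) \<subseteq> J - {e, p, q}" using J pq by blast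
      then have sub: "rays ((P - {p}) \<union> (Q - {q})) \<subseteq> rays (J - {e, p, q})"
        "rays ((P - {p}) \<union> (Q - {q})) \<subseteq> rays J"
        by (auto intro!: rays_mono)
      have S_dis: "(S \<union> (D1 \<union> D2 \<union> D3)) \<inter> rays ((P - {p}) \<union> (Q - {q})) = {}"
        using sub D(8) S(3) by blast
      have S_fin: "finite (S \<union> (D1 \<union> D2 \<union> D3))" "S \<union> (D1 \<union> D2 \<union> D3) \<subseteq> E"
        using S D(2,3) by (auto simp: EC_def)
      obtain K where K: "resolves (S \<union> (D1 \<union> D2 \<union> D3)) {} K"
        "\<And>U. splits A U \<Longrightarrow> m \<le> d U + hits {e, p, q} a U + cut_size K U"
        using match_exceptional[OF less.prems(1) ex JI pq(1,3) S_fin S_dis] by (elim exE conjE) blast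
      have "e \<in> I" "p \<in> I" "q \<in> I" using inJ JI by auto
      then have "\<exists>K'. resolves S {x} K' \<and> (\<forall>U. splits A U \<longrightarrow> m \<le> d U + cut_size K' U)"
        by (rule resolves_claw[OF K(1) D(2,3,7,4-6,9-11,1) _ _ _ neq cutf K(2)])
      then show ?thesis by blast
    qed
  qed
qed

end

section \<open>Menger's theorem for edges\<close>

lemma rtranclp_distinct_list:
  assumes "R\<^sup>*\<^sup>* a b"
  obtains xs where "xs \<noteq> []" "distinct xs" "hd xs = a" "last xs = b"
    "\<And>n. Suc n < length xs \<Longrightarrow> R (xs ! n) (xs ! Suc n)"
proof -
  have "\<exists>xs. xs \<noteq> [] \<and> distinct xs \<and> hd xs = a \<and> last xs = b \<and>
      (\<forall>n. Suc n < length xs \<longrightarrow> R (xs ! n) (xs ! Suc n))"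
    using assms
  proof (induction rule: rtranclp_induct)
    case base
    show ?case by (rule exI[of _ "[a]"]) simp
  next
    case (step y z)
    then obtain xs where xs: "xs \<noteq> []" "distinct xs" "hd xs = a" "last xs = y"
      "\<forall>n. Suc n < length xs \<longrightarrow> R (xs ! n) (xs ! Suc n)" by blast
    show ?case
    proof (cases "z \<in> set xs")
      case True
      then obtain n where n: "n < length xs" "xs ! n = z" by (auto simp: in_set_conv_nth)
      then have "last (take (Suc n) xs) = z" by (simp add: take_Suc_conv_app_nth)
      then show ?thesis using xs n by (intro exI[of _ "take (Suc n) xs"]) simp
    next
      case False
      have "R ((xs @ [z]) ! n) ((xs @ [z]) ! Suc n)" if "Suc n < length (xs @ [z])" for n
      proof (cases "Suc n < length xs")
        case True
        then show ?thesis using xs by (simp add: nth_append)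
      next
        case False
        then have "n = length xs - 1" "Suc n = length xs" using that xs(1) by auto
        then show ?thesis using xs step(2) by (simp add: nth_append last_conv_nth)
      qed
      then show ?thesis using xs False by (intro exI[of _ "xs @ [z]"]) simp
    qed
  qed
  then show thesis using that by blast
qed

section \<open>Arc-disjoint routes by lifting\<close>

definition outs :: "('l \<times> 'v \<times> 'v) set \<Rightarrow> 'v set \<Rightarrow> ('l \<times> 'v \<times> 'v) set" where
  "outs K U = {p \<in> K. fst (snd p) \<in> U \<and> snd (snd p) \<notin> U}"

lemma in_outs [simp]: "(L, u, v) \<in> outs K U \<longleftrightarrow> (L, u, v) \<in> K \<and> u \<in> U \<and> v \<notin> U"
  by (simp add: outs_def)

lemma finite_outs [simp]: "finite K \<Longrightarrow> finite (outs K U)"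
  by (simp add: outs_def)

lemma outs_Diff: "outs (K - L) U = outs K U - L"
  by (auto simp: outs_def)

lemma outs_insert: "outs (insert (L, u, v) K) U = (if u \<in> U \<and> v \<notin> U then insert (L, u, v) (outs K U) else outs K U)"
  by (auto simp: outs_def)

text \<open>\<open>Z\<close> collects the elements missing from both sets on the left: it is empty
  for submodularity and consists of two opposite arcs in \<open>menger_edge\<close>.\<close>

lemma card_add_le:
  assumes "finite C" "finite D" "A \<union> B \<subseteq> C \<union> D - Z" "A \<inter> B \<subseteq> C \<inter> D" "Z \<subseteq> C \<union> D"
  shows "card A + card B + card Z \<le> card C + card D"
proof -
  have fin: "finite (C \<union> D)" "finite Z" using assms(1,2,5) finite_subset by blast+
  then have finAB: "finite A" "finite B"
    using assms(3) by (meson finite_Diff finite_Un finite_subset)+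
  have "card (A \<union> B) \<le> card (C \<union> D) - card Z"
    using card_mono[OF _ assms(3)] fin card_Diff_subset[OF fin(2) assms(5)] by simp
  moreover have "card Z \<le> card (C \<union> D)" by (rule card_mono[OF fin(1) assms(5)])
  moreover have "card (A \<inter> B) \<le> card (C \<inter> D)" using assms by (intro card_mono) auto
  ultimately show ?thesis using card_Un_Int[OF finAB] card_Un_Int[OF assms(1,2)] by linarith
qed

lemma outs_submodular:
  assumes "finite K"
  shows "card (outs K (X \<union> Y)) + card (outs K (X \<inter> Y)) \<le> card (outs K X) + card (outs K Y)"
  using card_add_le[of "outs K X" "outs K Y" "outs K (X \<union> Y)" "outs K (X \<inter> Y)" "{}"] assms
  by (auto simp: outs_def)

text \<open>Induction on the number of arcs: an arc \<open>(a, w)\<close> can be deleted, or lifted together with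
  some arc \<open>(w, z)\<close> to a single arc \<open>(a, z)\<close>; otherwise the tight sets that block these operations
  have a tight union, and adding \<open>w\<close> to it violates the cut condition.\<close>

lemma directed_menger:
  fixes K :: "('e set \<times> 'v \<times> 'v) set"
  assumes trans: "\<And>L M u v w. Q L u v \<Longrightarrow> Q M v w \<Longrightarrow> Q (L \<union> M) u w"
    and "finite K" "disjoint_labels K"
    and "\<And>L u v. (L, u, v) \<in> K \<Longrightarrow> L \<noteq> {} \<and> Q L u v"
    and "\<And>U. a \<in> U \<Longrightarrow> b \<notin> U \<Longrightarrow> n \<le> card (outs K U)"
    and "a \<noteq> b"
  shows "\<exists>L. (\<forall>i<n. Q (L i) a b \<and> L i \<subseteq> \<Union>(fst ` K)) \<and>
    (\<forall>i<n. \<forall>j<n. i \<noteq> j \<longrightarrow> L i \<inter> L j = {})"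
  using assms(2-)
proof (induction "card K" arbitrary: K n rule: less_induct)
  case less
  note finK = less.prems(1) and dis = less.prems(2) and lab = less.prems(3) and cond = less.prems(4)
    and ab = less.prems(5)
  have labdis: "fst p \<inter> fst q = {}" if "p \<in> K" "q \<in> K" "p \<noteq> q" for p q
    using dis that unfolding disjoint_labels_def by blast
  have dis_sub: "disjoint_labels K'" if "K' \<subseteq> K" for K'
    using dis that unfolding disjoint_labels_def by blast
  show ?case
  proof (cases "n = 0")
    case False
    have "card (outs K {a}) \<noteq> 0" using cond[of "{a}"] ab False by auto
    then have "outs K {a} \<noteq> {}" by auto
    then obtain p where p: "p \<in> outs K {a}" by blast
    then obtain L w where f: "(L, a, w) \<in> K" "w \<noteq> a" by (cases p) (auto simp: outs_def)
    let ?f = "(L, a, w)"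
    have cardf: "card (K - {?f}) < card K" using finK f(1) by (rule card_Diff1_less)
    show ?thesis
    proof (cases "w = b")
      \<comment> \<open>An arc from \<open>a\<close> to \<open>b\<close> is a route by itself; it is
        removed and \<open>n\<close> is lowered by 1.\<close>
      case True
      have "n - 1 \<le> card (outs (K - {?f}) U)" if U: "a \<in> U" "b \<notin> U" for U
        using cond[OF U] f True U finK by (simp add: outs_Diff)
      then have "\<exists>M. (\<forall>i<n - 1. Q (M i) a b \<and> M i \<subseteq> \<Union>(fst ` (K - {?f}))) \<and>
          (\<forall>i<n - 1. \<forall>j<n - 1. i \<noteq> j \<longrightarrow> M i \<inter> M j = {})"
        using finK lab ab dis_sub[of "K - {?f}"] by (intro less.hyps[OF cardf]) auto
      then obtain M where M: "\<And>i. i < n - 1 \<Longrightarrow> Q (M i) a b \<and> M i \<subseteq> \<Union>(fst ` (K - {?f}))"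
        "\<And>i j. i < n - 1 \<Longrightarrow> j < n - 1 \<Longrightarrow> i \<noteq> j \<Longrightarrow> M i \<inter> M j = {}" by blast
      have disj_L: "M i \<inter> L = {}" if i: "i < n - 1" for i
      proof -
        have "fst q \<inter> L = {}" if "q \<in> K - {?f}" for q using labdis[of q ?f] that f(1) by simp
        then show ?thesis using M(1)[OF i] by blast
      qed
      let ?M = "M(n - 1 := L)"
      have "Q (?M i) a b \<and> ?M i \<subseteq> \<Union>(fst ` K)" if "i < n" for i
      proof (cases "i = n - 1")
        case True
        then show ?thesis using lab[OF f(1)] f(1) \<open>w = b\<close> by force
      next
        case False
        then have "i < n - 1" using that by simp
        then show ?thesis using M(1)[of i] False by auto
      qed
      moreover have "?M i \<inter> ?M j = {}" if "i < n" "j < n" "i \<noteq> j" for i j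
      proof -
        have "i = n - 1 \<or> i < n - 1" "j = n - 1 \<or> j < n - 1" using that by auto
        then show ?thesis using that(3) disj_L[of i] disj_L[of j] M(2)[of i j] by (auto simp: Int_commute)
      qed
      ultimately show ?thesis by blast
    next
      case wb: False
      show ?thesis
      proof (cases "\<forall>U. a \<in> U \<longrightarrow> b \<notin> U \<longrightarrow> n \<le> card (outs (K - {?f}) U)")
        case True
        then have "\<exists>M. (\<forall>i<n. Q (M i) a b \<and> M i \<subseteq> \<Union>(fst ` (K - {?f}))) \<and>
            (\<forall>i<n. \<forall>j<n. i \<noteq> j \<longrightarrow> M i \<inter> M j = {})"
          using finK lab ab dis_sub[of "K - {?f}"] by (intro less.hyps[OF cardf]) auto
        then obtain M where M: "\<forall>i<n. Q (M i) a b \<and> M i \<subseteq> \<Union>(fst ` (K - {?f}))"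
          "\<forall>i<n. \<forall>j<n. i \<noteq> j \<longrightarrow> M i \<inter> M j = {}" by (elim exE conjE)
        have sub: "\<Union>(fst ` (K - {?f})) \<subseteq> \<Union>(fst ` K)" by (intro Union_mono image_mono) auto
        have "Q (M i) a b \<and> M i \<subseteq> \<Union>(fst ` K)" if "i < n" for i
          by (rule conjI[OF _ subset_trans[OF _ sub]]) (use M(1) that in blast)+
        then show ?thesis using M(2) by (intro exI[of _ M]) simp
      next
        case nodel: False
        define lifted where "lifted M z = insert (L \<union> M, a, z) (K - {?f, (M, w, z)})" for M z
        show ?thesis
        proof (cases "\<exists>M z. (M, w, z) \<in> K \<and> (\<forall>U. a \<in> U \<longrightarrow> b \<notin> U \<longrightarrow> n \<le> card (outs (lifted M z) U))")
          case True
          then obtain M z where g: "(M, w, z) \<in> K" and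
            lc: "\<And>U. a \<in> U \<Longrightarrow> b \<notin> U \<Longrightarrow> n \<le> card (outs (lifted M z) U)" by blast
          have "?f \<noteq> (M, w, z)" using f by auto
          have newdis: "fst q \<inter> (L \<union> M) = {}" if "q \<in> K - {?f, (M, w, z)}" for q
            using labdis[of q ?f] labdis[of q "(M, w, z)"] that f(1) g by auto
          have Ls: "L \<noteq> {}" "Q L a w" "Q M w z" using lab[OF f(1)] lab[OF g] by auto
          have "card (lifted M z) < card K"
          proof -
            have "card (lifted M z) \<le> Suc (card (K - {?f, (M, w, z)}))"
              unfolding lifted_def by (rule card_insert_le_m1) (use finK in auto)
            moreover have "card (K - {?f, (M, w, z)}) = card K - 2"
              using f(1) g \<open>?f \<noteq> (M, w, z)\<close> by (simp add: card_Diff_subset)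
            moreover have "card {?f, (M, w, z)} \<le> card K" using f(1) g finK by (intro card_mono) auto
            ultimately show ?thesis using \<open>?f \<noteq> (M, w, z)\<close> by simp
          qed
          moreover have "disjoint_labels (lifted M z)"
            using newdis dis_sub[of "K - {?f, (M, w, z)}"]
            unfolding disjoint_labels_def lifted_def by (simp add: Int_commute)
          moreover have "L' \<noteq> {} \<and> Q L' u v" if "(L', u, v) \<in> lifted M z" for L' u v
            using that lab trans[OF Ls(2,3)] Ls(1) unfolding lifted_def by auto
          moreover have "finite (lifted M z)" using finK by (simp add: lifted_def)
          ultimately have "\<exists>N. (\<forall>i<n. Q (N i) a b \<and> N i \<subseteq> \<Union>(fst ` lifted M z)) \<and>
              (\<forall>i<n. \<forall>j<n. i \<noteq> j \<longrightarrow> N i \<inter> N j = {})"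
            using lc ab by (intro less.hyps) assumption+
          then obtain N where N: "\<forall>i<n. Q (N i) a b \<and> N i \<subseteq> \<Union>(fst ` lifted M z)"
            "\<forall>i<n. \<forall>j<n. i \<noteq> j \<longrightarrow> N i \<inter> N j = {}" by (elim exE conjE)
          have "L \<subseteq> \<Union>(fst ` K)" "M \<subseteq> \<Union>(fst ` K)" using f(1) g by force+
          moreover have "\<Union>(fst ` (K - {?f, (M, w, z)})) \<subseteq> \<Union>(fst ` K)"
            by (intro Union_mono image_mono) auto
          ultimately have sub: "\<Union>(fst ` lifted M z) \<subseteq> \<Union>(fst ` K)"
            unfolding lifted_def by simp
          have "Q (N i) a b \<and> N i \<subseteq> \<Union>(fst ` K)" if "i < n" for i
            by (rule conjI[OF _ subset_trans[OF _ sub]]) (use N(1) that in blast)+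
          then show ?thesis using N(2) by (intro exI[of _ N]) simp
        next
          case nolift: False
          \<comment> \<open>By the cut condition, exactly \<open>n\<close> arcs leave a tight
            set.\<close>
          define tight where "tight U \<longleftrightarrow> a \<in> U \<and> b \<notin> U \<and> w \<notin> U \<and> card (outs K U) \<le> n" for U
          from nodel obtain U0 where U0: "a \<in> U0" "b \<notin> U0" "card (outs K U0 - {?f}) < n"
            by (auto simp: outs_Diff not_le)
          have "w \<notin> U0"
          proof
            assume "w \<in> U0"
            then have "outs K U0 - {?f} = outs K U0" by auto
            then show False using U0 cond[of U0] by simp
          qed
          moreover have "card (outs K U0) \<le> n" using U0(3) by (simp add: card_Diff_singleton_if split: if_splits)
          ultimately have t0: "tight U0" using U0 by (simp add: tight_def)
          \<comment> \<open>The lift exchanges two arcs for one, and this changes the number of arcs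
            leaving \<open>U\<close> only if \<open>w \<notin> U\<close> and
            \<open>z \<in> U\<close>, when just \<open>?f\<close> is lost. A set violated by the
            lift is therefore tight and contains \<open>z\<close>.\<close>
          have tg: "\<exists>U. tight U \<and> z \<in> U" if g: "(M, w, z) \<in> K" for M z
          proof -
            let ?g = "(M, w, z)"
            obtain U where U: "a \<in> U" "b \<notin> U" "card (outs (lifted M z) U) < n"
              using nolift g by (meson not_le)
            have "(L \<union> M, a, z) \<notin> K - {?f, ?g}"
            proof
              assume *: "(L \<union> M, a, z) \<in> K - {?f, ?g}"
              then have "fst (L \<union> M, a, z) \<inter> fst ?f = {}" using f(1) by (intro labdis) auto
              then show False using lab[OF f(1)] by auto
            qed
            then have new: "(L \<union> M, a, z) \<notin> outs K U - {?f, ?g}" by (auto simp: outs_def)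
            have fin: "finite (outs K U)" using finK by simp
            have le: "n \<le> card (outs K U)" by (rule cond[OF U(1,2)])
            have lo: "outs (lifted M z) U = (if z \<notin> U then insert (L \<union> M, a, z) (outs K U - {?f, ?g})
                else outs K U - {?f, ?g})"
              unfolding lifted_def by (simp add: outs_insert outs_Diff U(1))
            have fU: "?f \<in> outs K U \<longleftrightarrow> w \<notin> U" and gU: "?g \<in> outs K U \<longleftrightarrow> w \<in> U \<and> z \<notin> U"
              using f(1) g U(1) by auto
            have ne: "card (outs K U) \<noteq> 0" using le False by linarith
            consider (1) "w \<notin> U" "z \<notin> U" | (2) "w \<in> U" "z \<notin> U" | (3) "w \<in> U" "z \<in> U" | (4) "w \<notin> U" "z \<in> U" by blast
            then show ?thesis
            proof cases
              case 1
              then have "outs K U - {?f, ?g} = outs K U - {?f}" using gU by blast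
              moreover have "card (outs K U - {?f}) = card (outs K U) - 1" using fU 1 by (simp add: card_Diff_singleton)
              ultimately have "card (outs (lifted M z) U) = Suc (card (outs K U) - 1)"
                using new 1 fin unfolding lo by simp
              then show ?thesis using U le ne by simp
            next
              case 2
              then have "outs K U - {?f, ?g} = outs K U - {?g}" using fU by blast
              moreover have "card (outs K U - {?g}) = card (outs K U) - 1" using gU 2 by (simp add: card_Diff_singleton)
              ultimately have "card (outs (lifted M z) U) = Suc (card (outs K U) - 1)"
                using new 2 fin unfolding lo by simp
              then show ?thesis using U le ne by simp
            next
              case 3
              then have "outs (lifted M z) U = outs K U" using fU gU unfolding lo by auto
              then show ?thesis using U le by simp
            next
              case 4
              then have "outs (lifted M z) U = outs K U - {?f}" using gU unfolding lo by auto
              moreover have "card (outs K U - {?f}) = card (outs K U) - 1" using fU 4 by (simp add: card_Diff_singleton)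
              ultimately have "card (outs K U) \<le> n" using U(3) by simp
              then show ?thesis using 4 U unfolding tight_def by blast
            qed
          qed
          have tUn: "tight (X \<union> Y)" if "tight X" "tight Y" for X Y
          proof -
            have "n \<le> card (outs K (X \<inter> Y))" using that by (intro cond) (auto simp: tight_def)
            then show ?thesis using that outs_submodular[OF finK, of X Y] by (auto simp: tight_def)
          qed
          have heads: "\<exists>U. tight U \<and> (\<forall>p\<in>G. snd (snd p) \<in> U)"
            if "finite G" "G \<subseteq> {p \<in> K. fst (snd p) = w}" for G
            using that
          proof (induction G rule: finite_induct)
            case empty
            then show ?case using t0 by blast
          next
            case (insert p G)
            then obtain U where U: "tight U" "\<forall>p\<in>G. snd (snd p) \<in> U" by auto
            obtain M z where "p = (M, w, z)" "(M, w, z) \<in> K" using insert.prems by (cases p) auto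
            then obtain U' where "tight U'" "snd (snd p) \<in> U'" using tg by fastforce
            then show ?case using tUn[OF U(1)] U(2) by (intro exI[of _ "U \<union> U'"]) auto
          qed
          obtain U where U: "tight U" "\<And>p. p \<in> K \<Longrightarrow> fst (snd p) = w \<Longrightarrow> snd (snd p) \<in> U"
            using heads[of "{p \<in> K. fst (snd p) = w}"] finK by auto
          \<comment> \<open>All arcs from \<open>w\<close> end in \<open>U\<close>, so adding
            \<open>w\<close> creates no leaving arc, while \<open>?f\<close> stops leaving.\<close>
          have "outs K (insert w U) \<subset> outs K U"
          proof
            show "outs K (insert w U) \<subseteq> outs K U" using U(2) by (auto simp: outs_def)
            have "?f \<in> outs K U" "?f \<notin> outs K (insert w U)" using f U(1) by (auto simp: tight_def)
            then show "outs K (insert w U) \<noteq> outs K U" by blast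
          qed
          then have "card (outs K (insert w U)) < n"
            using psubset_card_mono[OF finite_outs[OF finK]] U(1) unfolding tight_def
            by (meson less_le_trans)
          moreover have "n \<le> card (outs K (insert w U))" using U(1) wb by (intro cond) (auto simp: tight_def)
          ultimately show ?thesis by simp
        qed
      qed
    qed
  qed simp
qed

text \<open>Orienting both ways and choosing a minimal set of arcs with the cut condition leaves at most
  one orientation of each edge: two opposite essential arcs would lie in crossing tight sets.\<close>

theorem menger_edge:
  fixes F :: "'e set" and ends :: "'e \<Rightarrow> 'v \<times> 'v"
  assumes fin: "finite F" and loopless: "\<And>i. i \<in> F \<Longrightarrow> fst (ends i) \<noteq> snd (ends i)"
    and cond: "\<And>U. a \<in> U \<Longrightarrow> b \<notin> U \<Longrightarrow> n \<le> card {i \<in> F. (fst (ends i) \<in> U) \<noteq> (snd (ends i) \<in> U)}"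
    and ab: "a \<noteq> b"
  obtains L where "\<And>i. i < n \<Longrightarrow> L i \<subseteq> F"
    "\<And>i. i < n \<Longrightarrow> (\<lambda>x y. \<exists>e\<in>L i. ends e = (x, y) \<or> ends e = (y, x))\<^sup>*\<^sup>* a b"
    "\<And>i j. i < n \<Longrightarrow> j < n \<Longrightarrow> i \<noteq> j \<Longrightarrow> L i \<inter> L j = {}"
proof -
  let ?R = "\<lambda>L x y. \<exists>e\<in>L. ends e = (x, y) \<or> ends e = (y, x)"
  let ?up = "(\<lambda>i. ({i}, fst (ends i), snd (ends i)))" and ?down = "(\<lambda>i. ({i}, snd (ends i), fst (ends i)))"
  let ?A = "?up ` F \<union> ?down ` F"
  define good where "good K \<longleftrightarrow> K \<subseteq> ?A \<and> (\<forall>U. a \<in> U \<longrightarrow> b \<notin> U \<longrightarrow> n \<le> card (outs K U))" for K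
  have "n \<le> card (outs ?A U)" if U: "a \<in> U" "b \<notin> U" for U
  proof -
    let ?X = "{i \<in> F. (fst (ends i) \<in> U) \<noteq> (snd (ends i) \<in> U)}"
    have "(\<lambda>i. if fst (ends i) \<in> U then ?up i else ?down i) ` ?X \<subseteq> outs ?A U" by (auto simp: outs_def)
    moreover have "inj_on (\<lambda>i. if fst (ends i) \<in> U then ?up i else ?down i) ?X"
      by (rule inj_onI) (auto split: if_splits)
    ultimately have "card ?X \<le> card (outs ?A U)" using fin by (metis (no_types, lifting) card_inj_on_le finite_UnI finite_imageI finite_outs)
    then show ?thesis using cond[OF U] by simp
  qed
  then have "good ?A" by (simp add: good_def)
  then obtain K where K: "good K" and min: "\<And>K'. good K' \<Longrightarrow> card K \<le> card K'"
    using ex_has_least_nat[of good ?A card] by blast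
  have KA: "K \<subseteq> ?A" using K by (simp add: good_def)
  moreover have "finite ?A" using fin by simp
  ultimately have finK: "finite K" by (rule finite_subset)
  have tight: "\<exists>U. a \<in> U \<and> b \<notin> U \<and> p \<in> outs K U \<and> card (outs K U) \<le> n" if p: "p \<in> K" for p
  proof -
    have "\<not> good (K - {p})" using min[of "K - {p}"] card_Diff1_less[OF finK p] by linarith
    then obtain U where U: "a \<in> U" "b \<notin> U" "card (outs K U - {p}) < n"
      using KA by (auto simp: good_def outs_Diff not_le)
    moreover have le: "n \<le> card (outs K U)" using K U by (simp add: good_def)
    ultimately have "p \<in> outs K U" by (metis Diff_empty Diff_insert0 not_le)
    moreover from this have "card (outs K U) \<le> n" using U(3) by (simp add: card_Diff_singleton)
    ultimately show ?thesis using U by blast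
  qed
  have dis: "disjoint_labels K"
    unfolding disjoint_labels_def
  proof (intro ballI impI)
    fix p q assume pq: "p \<in> K" "q \<in> K" "p \<noteq> q"
    show "fst p \<inter> fst q = {}"
    proof (rule ccontr)
      assume ne: "fst p \<inter> fst q \<noteq> {}"
      obtain i where i: "i \<in> F" "p = ?up i \<or> p = ?down i" using pq KA by blast
      obtain j where j: "q = ?up j \<or> q = ?down j" using pq KA by blast
      have "fst p = {i}" "fst q = {j}" using i(2) j by auto
      then have "i = j" using ne by simp
      then obtain u v where uv: "p = ({i}, u, v)" "q = ({i}, v, u)" "u \<noteq> v"
        using i j pq(3) loopless[OF i(1)] by (cases "ends i") auto
      obtain X where X: "a \<in> X" "b \<notin> X" "p \<in> outs K X" "card (outs K X) \<le> n" using tight[OF pq(1)] by blast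
      obtain Y where Y: "a \<in> Y" "b \<notin> Y" "q \<in> outs K Y" "card (outs K Y) \<le> n" using tight[OF pq(2)] by blast
      \<comment> \<open>One end of the edge lies in \<open>X - Y\<close> and the other in
        \<open>Y - X\<close>, so neither orientation leaves the union or the intersection. These two
        cuts together lose 2 against \<open>2 * n\<close>, below the cut condition.\<close>
      have "outs K (X \<union> Y) \<union> outs K (X \<inter> Y) \<subseteq> outs K X \<union> outs K Y - {p, q}"
        using X(3) Y(3) uv by (auto simp: outs_def)
      moreover have "outs K (X \<union> Y) \<inter> outs K (X \<inter> Y) \<subseteq> outs K X \<inter> outs K Y" by (auto simp: outs_def)
      ultimately have "card (outs K (X \<union> Y)) + card (outs K (X \<inter> Y)) + card {p, q}
          \<le> card (outs K X) + card (outs K Y)"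
        using X(3) Y(3) finK by (intro card_add_le) auto
      moreover have "n \<le> card (outs K (X \<union> Y))" "n \<le> card (outs K (X \<inter> Y))"
        using K X Y by (auto simp: good_def)
      ultimately show False using X(4) Y(4) pq(3) by simp
    qed
  qed
  have "\<exists>L. (\<forall>i<n. ((?R (L i))\<^sup>*\<^sup>* a b) \<and> L i \<subseteq> \<Union>(fst ` K)) \<and> (\<forall>i<n. \<forall>j<n. i \<noteq> j \<longrightarrow> L i \<inter> L j = {})"
  proof (rule directed_menger)
    fix L M :: "'e set" and u v w assume "(?R L)\<^sup>*\<^sup>* u v" "(?R M)\<^sup>*\<^sup>* v w"
    then have "(?R (L \<union> M))\<^sup>*\<^sup>* u v" "(?R (L \<union> M))\<^sup>*\<^sup>* v w"
      by (auto elim: rtranclp_mono[THEN predicate2D, rotated])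
    then show "(?R (L \<union> M))\<^sup>*\<^sup>* u w" by (rule rtranclp_trans)
  next
    fix L u v assume "(L, u, v) \<in> K"
    then have "(L, u, v) \<in> ?A" using KA by blast
    then obtain i where "L = {i}" "ends i = (u, v) \<or> ends i = (v, u)" by (auto simp: prod_eq_iff)
    then show "L \<noteq> {} \<and> (?R L)\<^sup>*\<^sup>* u v" by (auto intro!: r_into_rtranclp)
  next
    show "n \<le> card (outs K U)" if "a \<in> U" "b \<notin> U" for U using K that by (simp add: good_def)
  qed (fact finK dis ab)+
  then obtain L where L: "\<forall>i<n. (?R (L i))\<^sup>*\<^sup>* a b \<and> L i \<subseteq> \<Union>(fst ` K)"
    "\<forall>i<n. \<forall>j<n. i \<noteq> j \<longrightarrow> L i \<inter> L j = {}" by (elim exE conjE)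
  have KF: "\<Union>(fst ` K) \<subseteq> F" using KA by auto
  show thesis
  proof (rule that)
    show "L i \<subseteq> F" if "i < n" for i using L(1) that KF by (meson subset_trans)
    show "(?R (L i))\<^sup>*\<^sup>* a b" if "i < n" for i using L(1) that by simp
    show "L i \<inter> L j = {}" if "i < n" "j < n" "i \<noteq> j" for i j using L(2) that by simp
  qed
qed

text \<open>Besides \<open>n\<close> disjoint paths, \<open>GREATEST\<close> needs an upper bound.
  As \<open>a \<noteq> b\<close>, every path has a first edge, and disjointness makes these
  distinct, so there are at most \<open>card F\<close> paths.\<close>

lemma mlambda_ge:
  assumes F: "multigraph W F ends" and ab: "a \<noteq> b"
    and cond: "\<And>U. a \<in> U \<Longrightarrow> b \<notin> U \<Longrightarrow> n \<le> card {i \<in> F. (fst (ends i) \<in> U) \<noteq> (snd (ends i) \<in> U)}"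
  shows "n \<le> mlambda F ends a b"
proof -
  have finF: "finite F" using F by (simp add: multigraph_def)
  obtain L where L: "\<And>i. i < n \<Longrightarrow> L i \<subseteq> F"
    "\<And>i. i < n \<Longrightarrow> (\<lambda>x y. \<exists>e\<in>L i. ends e = (x, y) \<or> ends e = (y, x))\<^sup>*\<^sup>* a b"
    "\<And>i j. i < n \<Longrightarrow> j < n \<Longrightarrow> i \<noteq> j \<Longrightarrow> L i \<inter> L j = {}"
    by (rule menger_edge[OF finF _ cond ab]) (use F in \<open>auto simp: multigraph_def\<close>)
  have "\<exists>p. mpath F ends a b p \<and> set (snd p) \<subseteq> L i" if i: "i < n" for i
  proof -
    obtain vs where vs: "vs \<noteq> []" "distinct vs" "hd vs = a" "last vs = b"
      "\<And>n. Suc n < length vs \<Longrightarrow> \<exists>e\<in>L i. ends e = (vs ! n, vs ! Suc n) \<or> ends e = (vs ! Suc n, vs ! n)"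
      using rtranclp_distinct_list[OF L(2)[OF i]] by blast
    then obtain f where f: "\<And>n. Suc n < length vs \<Longrightarrow> f n \<in> L i \<and>
        (ends (f n) = (vs ! n, vs ! Suc n) \<or> ends (f n) = (vs ! Suc n, vs ! n))" by metis
    let ?es = "map f [0..<length vs - 1]"
    have "mpath F ends a b (vs, ?es)" using vs f L(1)[OF i] by (auto simp: mpath_def)
    moreover have "set ?es \<subseteq> L i" using f by auto
    ultimately show ?thesis by (intro exI[of _ "(vs, ?es)"]) simp
  qed
  then obtain p where p: "\<And>i. i < n \<Longrightarrow> mpath F ends a b (p i) \<and> set (snd (p i)) \<subseteq> L i" by metis
  let ?P = "\<lambda>n. \<exists>p :: nat \<Rightarrow> 'a list \<times> nat list. (\<forall>i<n. mpath F ends a b (p i)) \<and>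
      (\<forall>i<n. \<forall>j<n. i \<noteq> j \<longrightarrow> set (snd (p i)) \<inter> set (snd (p j)) = {})"
  have "?P n" using p L(3) by (intro exI[of _ p]) blast
  moreover have "y \<le> card F" if y: "?P y" for y
  proof -
    obtain p :: "nat \<Rightarrow> 'a list \<times> nat list" where "(\<forall>i<y. mpath F ends a b (p i)) \<and>
      (\<forall>i<y. \<forall>j<y. i \<noteq> j \<longrightarrow> set (snd (p i)) \<inter> set (snd (p j)) = {})" using y by (elim exE)
    then have p: "\<And>i. i < y \<Longrightarrow> mpath F ends a b (p i)"
      "\<And>i j. i < y \<Longrightarrow> j < y \<Longrightarrow> i \<noteq> j \<Longrightarrow> set (snd (p i)) \<inter> set (snd (p j)) = {}" by blast+
    have ne: "snd (p i) \<noteq> []" "set (snd (p i)) \<subseteq> F" if "i < y" for i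
    proof -
      obtain vs es where pi: "p i = (vs, es)" by (cases "p i")
      have m: "mpath F ends a b (vs, es)" using p(1)[OF that] pi by simp
      have "es \<noteq> []"
      proof
        assume "es = []"
        then have "length vs = 1" using m by (simp add: mpath_def)
        then obtain v where "vs = [v]" by (auto simp: length_Suc_conv)
        then show False using m ab unfolding mpath_def by auto
      qed
      then show "snd (p i) \<noteq> []" "set (snd (p i)) \<subseteq> F" using pi m by (auto simp: mpath_def in_set_conv_nth)
    qed
    then have hd_in: "hd (snd (p i)) \<in> set (snd (p i))" if "i < y" for i using that by simp
    then have "inj_on (\<lambda>i. hd (snd (p i))) {..<y}"
      using p(2) by (intro inj_onI) (metis disjoint_iff lessThan_iff)
    moreover have "(\<lambda>i. hd (snd (p i))) ` {..<y} \<subseteq> F" using hd_in ne(2) by blast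
    ultimately show ?thesis using card_inj_on_le[OF _ _ finF] by fastforce
  qed
  ultimately show ?thesis unfolding mlambda_def by (intro Greatest_le_nat) blast+
qed

section \<open>Components outside the prescribed set\<close>

lemma gpath_joins:
  assumes "gpath V E p"
  shows "joins {e \<in> E. e \<subseteq> set p} (hd p) (last p)"
proof -
  have ne: "p \<noteq> []" and step: "\<And>n. Suc n < length p \<Longrightarrow> {p ! n, p ! Suc n} \<in> E"
    using assms by (auto simp: gpath_def)
  have "joins {e \<in> E. e \<subseteq> set p} (p ! 0) (p ! n)" if "n < length p" for n
    using that
  proof (induction n)
    case (Suc n)
    have "{p ! n, p ! Suc n} \<in> {e \<in> E. e \<subseteq> set p}" using step[OF Suc.prems] Suc.prems by auto
    then have "joins {e \<in> E. e \<subseteq> set p} (p ! n) (p ! Suc n)" by (rule joins_edge)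
    then show ?case using joins_trans[OF Suc.IH] Suc.prems by simp
  qed simp
  from this[of "length p - 1"] show ?thesis using ne by (simp add: hd_conv_nth last_conv_nth)
qed

text \<open>Each vertex of \<open>Y\<close> lies on at most one of infinitely many disjoint paths,
  so one of them misses \<open>Y\<close>.\<close>

lemma equivalent_rays_avoiding:
  assumes "equivalent_rays V E r s" "finite Y"
  shows "\<exists>m n. r m \<notin> Y \<and> joins {e \<in> E. e \<inter> Y = {}} (r m) (s n)"
proof -
  obtain P where P0: "infinite P" "\<forall>p\<in>P. gpath V E p \<and> hd p \<in> range r \<and> last p \<in> range s"
    "\<forall>p\<in>P. \<forall>q\<in>P. p \<noteq> q \<longrightarrow> set p \<inter> set q = {}"
    using assms(1) unfolding equivalent_rays_def by (elim exE conjE)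
  note P = P0(1) P0(2)[rule_format] P0(3)[rule_format]
  let ?B = "{p \<in> P. set p \<inter> Y \<noteq> {}}"
  define g where "g p = (SOME y. y \<in> set p \<inter> Y)" for p
  have g: "g p \<in> set p \<inter> Y" if "p \<in> ?B" for p
    using that unfolding g_def some_in_eq by blast
  have "inj_on g ?B"
  proof (rule inj_onI, rule ccontr)
    fix p q assume "p \<in> ?B" "q \<in> ?B" "g p = g q" "p \<noteq> q"
    then show False using g[of p] g[of q] P(3)[of p q] by auto
  qed
  moreover have "g ` ?B \<subseteq> Y" using g by blast
  ultimately have "finite ?B" using assms(2) inj_on_finite by blast
  then have "P \<noteq> ?B" using P(1) by auto
  then obtain p where p: "p \<in> P" "set p \<inter> Y = {}" by blast
  obtain m n where mn: "hd p = r m" "last p = s n" using P(2)[OF p(1)] by blast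
  have "p \<noteq> []" using P(2)[OF p(1)] by (auto simp: gpath_def)
  then have "r m \<notin> Y" using p(2) hd_in_set[of p] mn by auto
  moreover have "joins {e \<in> E. e \<inter> Y = {}} (r m) (s n)"
    using gpath_joins[of V E p] P(2)[OF p(1)] p(2) mn by (auto elim!: joins_mono)
  ultimately show ?thesis by blast
qed

text \<open>The last clause makes the path the edge itself whenever possible; applied to the label
  \<open>{{u, v}}\<close> it keeps the edges of \<open>G\<close> inside \<open>A\<close>.\<close>

lemma joins_gpath:
  assumes "joins D u v" "D \<subseteq> E" "u \<in> V" "\<And>e. e \<in> E \<Longrightarrow> e \<subseteq> V" "u \<noteq> v"
  obtains xs where "gpath V E xs" "hd xs = u" "last xs = v" "path_edges xs \<subseteq> D"
    "{u, v} \<in> D \<Longrightarrow> xs = [u, v]"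
proof (cases "{u, v} \<in> D")
  case True
  then have "gpath V E [u, v]" using assms by (auto simp: gpath_def)
  moreover have "path_edges [u, v] \<subseteq> D" using True by (auto simp: path_edges_def)
  ultimately show thesis using that[of "[u, v]"] by simp
next
  case False
  obtain xs where xs: "xs \<noteq> []" "distinct xs" "hd xs = u" "last xs = v"
    "\<And>n. Suc n < length xs \<Longrightarrow> {xs ! n, xs ! Suc n} \<in> D"
    using rtranclp_distinct_list[OF assms(1)[unfolded joins_def]] by blast
  have "xs ! n \<in> V" if "n < length xs" for n
  proof (cases n)
    case 0
    then show ?thesis using xs assms(3) by (simp add: hd_conv_nth)
  next
    case (Suc l)
    then have "{xs ! l, xs ! Suc l} \<subseteq> V" using xs(5)[of l] that assms(2,4) by blast
    then show ?thesis using Suc by simp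
  qed
  then have "set xs \<subseteq> V" by (auto simp: in_set_conv_nth)
  then have "gpath V E xs" using xs assms(2) by (auto simp: gpath_def)
  moreover have "path_edges xs \<subseteq> D" using xs(5) by (auto simp: path_edges_def)
  ultimately show thesis using that[of xs] xs False by blast
qed

text \<open>\<open>m\<close> stands for \<open>2 * k\<close>. A vertex in \<open>A\<close> lies
  outside every component, so each component has at least \<open>m\<close> boundary edges; for empty
  \<open>A\<close> the empty multigraph is a solution.\<close>

locale linked_graph =
  fixes V :: "'v set" and E :: "'v set set" and A :: "'v set" and m :: nat
  assumes simple: "simple_graph V E"
    and locally_finite: "locally_finite V E"
    and connected: "edge_connected m V E"
    and finA: "finite A" and AV: "A \<subseteq> V" and A_ne: "A \<noteq> {}"
    and linked: "component_minus V E A C \<Longrightarrow> boundary_linked V E C"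
    and m: "even m" "m \<ge> 4"
begin

definition comps :: "'v set set" where
  "comps = {C. component_minus V E A C}"

lemma edgeE:
  assumes "e \<in> E"
  obtains u v where "e = {u, v}" "u \<noteq> v" "u \<in> V" "v \<in> V"
  using assms simple unfolding simple_graph_def by blast

definition outside :: "'v \<Rightarrow> 'v \<Rightarrow> bool" where
  "outside x y \<longleftrightarrow> x \<in> V - A \<and> y \<in> V - A \<and> {x, y} \<in> E"

lemma outside_sym: "outside\<^sup>*\<^sup>* x y \<Longrightarrow> outside\<^sup>*\<^sup>* y x"
  by (rule sympD[OF symp_rtranclp]) (auto simp: symp_def outside_def insert_commute)

lemma comps_iff: "C \<in> comps \<longleftrightarrow> (\<exists>u\<in>V - A. C = {v. outside\<^sup>*\<^sup>* u v})"
  unfolding comps_def component_minus_def outside_def by simp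

lemma comp_eq:
  assumes "C \<in> comps" "x \<in> C"
  shows "C = {v. outside\<^sup>*\<^sup>* x v}"
proof -
  obtain u where u: "C = {v. outside\<^sup>*\<^sup>* u v}" using assms(1) comps_iff by blast
  then have "outside\<^sup>*\<^sup>* u x" using assms(2) by simp
  then show ?thesis unfolding u using outside_sym by (auto intro: rtranclp_trans)
qed

lemma comp_unique: "C \<in> comps \<Longrightarrow> C' \<in> comps \<Longrightarrow> x \<in> C \<Longrightarrow> x \<in> C' \<Longrightarrow> C = C'"
  using comp_eq by blast

lemma comp_subset:
  assumes "C \<in> comps"
  shows "C \<subseteq> V - A"
proof -
  obtain u where u: "u \<in> V - A" "C = {v. outside\<^sup>*\<^sup>* u v}" using assms comps_iff by blast
  have "v \<in> V - A" if "outside\<^sup>*\<^sup>* u v" for v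
    using that u(1) by (induction rule: rtranclp_induct) (auto simp: outside_def)
  then show ?thesis using u(2) by blast
qed

lemma comp_nonempty: "C \<in> comps \<Longrightarrow> C \<noteq> {}"
  unfolding comps_iff by blast

lemma comp_exists:
  assumes "v \<in> V - A"
  obtains C where "C \<in> comps" "v \<in> C"
  using assms that[of "{w. outside\<^sup>*\<^sup>* v w}"] unfolding comps_iff by blast

lemma comp_edge:
  assumes C: "C \<in> comps" and e: "e \<in> E" "e \<inter> C \<noteq> {}"
  shows "e \<subseteq> C \<union> A"
proof
  fix y assume y: "y \<in> e"
  obtain x where x: "x \<in> e" "x \<in> C" using e(2) by blast
  show "y \<in> C \<union> A"
  proof (cases "y = x \<or> y \<in> A")
    case False
    then have "e = {x, y}" "y \<in> V - A" using edgeE[OF e(1)] x(1) y by blast+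
    then have "outside x y" using e(1) x(2) comp_subset[OF C] by (auto simp: outside_def)
    then show ?thesis using comp_eq[OF C x(2)] by auto
  qed (use x in auto)
qed

lemma edge_comps_unique:
  assumes "C \<in> comps" "C' \<in> comps" "e \<in> E" "e \<inter> C \<noteq> {}" "e \<inter> C' \<noteq> {}"
  shows "C = C'"
proof -
  obtain x where x: "x \<in> e" "x \<in> C'" using assms(5) by blast
  then have "x \<in> C \<union> A" using comp_edge[OF assms(1,3,4)] by blast
  then show ?thesis using comp_unique[OF assms(1,2)] x comp_subset[OF assms(2)] by blast
qed

lemma boundary_iff:
  assumes C: "C \<in> comps"
  shows "e \<in> boundary E C \<longleftrightarrow> e \<in> E \<and> (\<exists>u w. e = {u, w} \<and> u \<in> A \<and> w \<in> C)"
proof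
  assume "e \<in> boundary E C"
  then have e: "e \<in> E" "card (e \<inter> C) = 1" by (auto simp: boundary_def)
  obtain u w where uw: "e = {u, w}" "u \<noteq> w" using edgeE[OF e(1)] by metis
  have "e \<inter> C \<noteq> {}" using e(2) by auto
  then have sub: "e \<subseteq> C \<union> A" by (rule comp_edge[OF C e(1)])
  have "\<not> e \<subseteq> C"
  proof
    assume "e \<subseteq> C"
    then have "e \<inter> C = {u, w}" using uw by blast
    then show False using e(2) uw(2) by simp
  qed
  then have "u \<in> A \<and> w \<in> C \<or> w \<in> A \<and> u \<in> C" using sub uw(1) \<open>e \<inter> C \<noteq> {}\<close> by blast
  then show "e \<in> E \<and> (\<exists>u w. e = {u, w} \<and> u \<in> A \<and> w \<in> C)" using e(1) uw(1) insert_commute by blast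
next
  assume "e \<in> E \<and> (\<exists>u w. e = {u, w} \<and> u \<in> A \<and> w \<in> C)"
  then obtain u w where e: "e \<in> E" "e = {u, w}" "u \<in> A" "w \<in> C" by blast
  then have "e \<inter> C = {w}" using comp_subset[OF C] by blast
  then show "e \<in> boundary E C" using e(1) by (simp add: boundary_def)
qed

lemma finite_touching:
  assumes "finite B" "B \<subseteq> V"
  shows "finite {e \<in> E. e \<inter> B \<noteq> {}}"
proof (rule finite_subset)
  show "{e \<in> E. e \<inter> B \<noteq> {}} \<subseteq> (\<Union>v\<in>B. (\<lambda>u. {u, v}) ` {u. {u, v} \<in> E})"
  proof
    fix e assume e: "e \<in> {e \<in> E. e \<inter> B \<noteq> {}}"
    then obtain v where v: "v \<in> e" "v \<in> B" by blast
    obtain x y where "e = {x, y}" using e edgeE by blast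
    then obtain u where "e = {u, v}" using v(1) by (auto simp: insert_commute)
    then show "e \<in> (\<Union>v\<in>B. (\<lambda>u. {u, v}) ` {u. {u, v} \<in> E})" using e v by blast
  qed
  show "finite (\<Union>v\<in>B. (\<lambda>u. {u, v}) ` {u. {u, v} \<in> E})"
    using assms locally_finite by (auto simp: locally_finite_def)
qed

lemma graph_cut:
  assumes "x \<in> V" "x \<in> W" "y \<in> V" "y \<notin> W" "finite {e \<in> E. e \<inter> W \<noteq> {} \<and> \<not> e \<subseteq> W}"
  shows "m \<le> card {e \<in> E. e \<inter> W \<noteq> {} \<and> \<not> e \<subseteq> W}"
proof (rule ccontr)
  let ?S = "{e \<in> E. e \<inter> W \<noteq> {} \<and> \<not> e \<subseteq> W}"
  assume "\<not> m \<le> card ?S"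
  then have "connected_graph V (E - ?S)"
    using connected assms(5) unfolding edge_connected_def by (metis (no_types, lifting) mem_Collect_eq not_le subsetI)
  then have "joins (E - ?S) x y" using assms(1,3) by (simp add: connected_graph_def joins_def)
  then have "y \<in> W" by (induction rule: joins_induct) (use assms(2) in auto)
  then show False using assms(4) by blast
qed

lemma finite_boundary: "C \<in> comps \<Longrightarrow> finite (boundary E C)"
  by (rule finite_subset[OF _ finite_touching[OF finA AV]]) (auto simp: boundary_iff)

lemma card_boundary:
  assumes C: "C \<in> comps"
  shows "m \<le> card (boundary E C)"
proof -
  have eq: "{e \<in> E. e \<inter> C \<noteq> {} \<and> \<not> e \<subseteq> C} = boundary E C"
  proof (intro equalityI subsetI)
    fix e assume e: "e \<in> {e \<in> E. e \<inter> C \<noteq> {} \<and> \<not> e \<subseteq> C}"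
    then have "e \<subseteq> C \<union> A" using comp_edge[OF C] by simp
    moreover have "e \<in> E" using e by simp
    moreover obtain x y where xy: "e = {x, y}" by (rule edgeE[OF \<open>e \<in> E\<close>])
    ultimately have "x \<in> A \<and> y \<in> C \<or> y \<in> A \<and> x \<in> C" using e by auto
    moreover have "e = {y, x}" using xy by (simp add: insert_commute)
    ultimately show "e \<in> boundary E C" using e xy unfolding boundary_iff[OF C] by blast
  next
    fix e assume "e \<in> boundary E C"
    then show "e \<in> {e \<in> E. e \<inter> C \<noteq> {} \<and> \<not> e \<subseteq> C}"
      unfolding boundary_iff[OF C] using comp_subset[OF C] by auto
  qed
  obtain x where x: "x \<in> C" using comp_nonempty[OF C] by blast
  obtain y where y: "y \<in> A" using A_ne by blast
  have "x \<in> V" "y \<in> V" "y \<notin> C" using x y comp_subset[OF C] AV by auto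
  then show ?thesis using graph_cut[of x C y] x finite_boundary[OF C] unfolding eq by blast
qed

text \<open>Every component has a boundary edge, no edge serves two components, and by local
  finiteness only finitely many edges meet \<open>A\<close>.\<close>

lemma finite_comps: "finite comps"
proof -
  define g where "g C = (SOME e. e \<in> boundary E C)" for C
  have g: "g C \<in> boundary E C" if "C \<in> comps" for C
  proof -
    have "boundary E C \<noteq> {}" using card_boundary[OF that] m by auto
    then show ?thesis unfolding g_def some_in_eq by blast
  qed
  have "inj_on g comps"
  proof (rule inj_onI)
    fix C C' assume C: "C \<in> comps" "C' \<in> comps" "g C = g C'"
    then have "g C \<in> E" "g C \<inter> C \<noteq> {}" "g C \<inter> C' \<noteq> {}"
      using g[OF C(1)] g[OF C(2)] unfolding boundary_iff[OF C(1)] boundary_iff[OF C(2)] by auto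
    then show "C = C'" using edge_comps_unique C by blast
  qed
  moreover have "g ` comps \<subseteq> {e \<in> E. e \<inter> A \<noteq> {}}" using g boundary_iff by fastforce
  ultimately show ?thesis using finite_touching[OF finA AV] by (rule inj_on_finite)
qed

lemma rays_exist:
  assumes C: "C \<in> comps"
  obtains r where "ray_system E A C (boundary E C) r" "\<And>e. e \<in> boundary E C \<Longrightarrow> e = {r e 0, r e 1}"
proof -
  obtain R where R0: "\<forall>r\<in>R. ray V E r \<and> ray_edges r \<subseteq> {e \<in> E. e \<subseteq> C} \<union> boundary E C"
    "\<forall>r\<in>R. \<forall>s\<in>R. r \<noteq> s \<longrightarrow> ray_edges r \<inter> ray_edges s = {}"
    "\<forall>r\<in>R. \<forall>s\<in>R. equivalent_rays V E r s"
    "\<forall>e\<in>boundary E C. \<exists>r\<in>R. {r 0, r 1} = e"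
    using linked[OF C[unfolded comps_def mem_Collect_eq]] unfolding boundary_linked_def
    by (elim exE conjE)
  note R = R0(1-3)[rule_format] bspec[OF R0(4)]
  have "\<exists>r. \<forall>e\<in>boundary E C. r e \<in> R \<and> {r e 0, r e 1} = e"
    using R(4) by (intro bchoice) blast
  then obtain r where r: "\<And>e. e \<in> boundary E C \<Longrightarrow> r e \<in> R \<and> {r e 0, r e 1} = e" by blast
  \<comment> \<open>Every boundary edge is the first edge of some ray in \<open>R\<close>. By
    edge-disjointness and injectivity, no ray uses a boundary edge later on, so it stays in
    \<open>C\<close> from its second vertex.\<close>
  have sne: "{s n, s (Suc n)} \<subseteq> C" if s: "s \<in> R" and n: "n \<noteq> 0" for s n
  proof (rule ccontr)
    assume *: "\<not> {s n, s (Suc n)} \<subseteq> C"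
    have in_s: "{s n, s (Suc n)} \<in> ray_edges s" by (auto simp: ray_edges_def)
    then have "{s n, s (Suc n)} \<in> boundary E C" using R(1)[OF s] * by blast
    then obtain t where t: "t \<in> R" "{t 0, t 1} = {s n, s (Suc n)}" using R(4) by blast
    have "{t 0, t 1} \<in> ray_edges t" by (auto simp: ray_edges_def intro!: exI[of _ 0])
    then have "t = s" using R(2)[OF t(1) s] in_s t(2) by auto
    moreover have "inj s" using R(1)[OF s] by (simp add: ray_def)
    ultimately show False using t(2) n by (auto simp: doubleton_eq_iff inj_eq)
  qed
  have tail: "r e (Suc n) \<in> C" if "e \<in> boundary E C" for e n
    using sne[of "r e" "Suc n"] r[OF that] by auto
  have AC: "A \<inter> C = {}" using comp_subset[OF C] by blast
  have start: "r e 0 \<in> A" if e: "e \<in> boundary E C" for e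
  proof -
    obtain u w where uw: "e = {u, w}" "u \<in> A" "w \<in> C" using e boundary_iff[OF C] by blast
    have "u \<noteq> r e 1" using tail[OF e, of 0] uw(2) AC by auto
    then have "u = r e 0" using r[OF e] uw(1) by (auto simp: doubleton_eq_iff)
    then show ?thesis using uw by simp
  qed
  have "ray_system E A C (boundary E C) r"
  proof
    show "\<exists>u v. e = {u, v}" if "e \<in> E" for e using edgeE[OF that] by metis
    show "e \<subseteq> C \<union> A" if "e \<in> E" "e \<inter> C \<noteq> {}" for e using comp_edge[OF C that] .
    show "{r i n, r i (Suc n)} \<in> E" "inj (r i)" if "i \<in> boundary E C" for i n
      using R(1) r[OF that] by (auto simp: ray_def)
    show "ray_edges (r i) \<inter> ray_edges (r j) = {}" if "i \<in> boundary E C" "j \<in> boundary E C" "i \<noteq> j" for i j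
    proof (rule R(2))
      show "r i \<in> R" "r j \<in> R" using r[OF that(1)] r[OF that(2)] by blast+
      show "r i \<noteq> r j" using r[OF that(1)] r[OF that(2)] that(3) by metis
    qed
    show "\<exists>m n. r i m \<notin> Y \<and> joins {e \<in> E. e \<inter> Y = {}} (r i m) (r j n)"
      if "i \<in> boundary E C" "j \<in> boundary E C" "finite Y" for i j Y
      using equivalent_rays_avoiding[OF R(3) that(3)] r[OF that(1)] r[OF that(2)] by simp
  qed (fact finA AC finite_boundary[OF C] start tail)+
  then show thesis using that[of r] r by auto
qed

end

section \<open>Expanding the components one by one\<close>

context linked_graph
begin

lemma edge_subset: "e \<in> E \<Longrightarrow> e \<subseteq> V"
  by (erule edgeE) simp

definition rep :: "'v set \<Rightarrow> 'v" where
  "rep C = (SOME v. v \<in> C)"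

definition A_end :: "'v set \<Rightarrow> 'v" where
  "A_end e = (SOME u. u \<in> e \<inter> A)"

lemma rep_in: "C \<in> comps \<Longrightarrow> rep C \<in> C"
  unfolding rep_def some_in_eq by (rule comp_nonempty)

lemma A_end_eq:
  assumes "u \<in> A" "w \<notin> A"
  shows "A_end {u, w} = u"
proof -
  have "{u, w} \<inter> A = {u}" using assms by auto
  then show ?thesis unfolding A_end_def by simp
qed

text \<open>The star of the vertex to which a component \<open>C\<close> of \<open>G - A\<close> is contracted; \<open>rep C\<close> stands for
  that vertex.\<close>

definition star_of :: "'v set \<Rightarrow> ('v set set \<times> 'v \<times> 'v) set" where
  "star_of C = (\<lambda>e. ({e}, A_end e, rep C)) ` boundary E C"

definition stars :: "'v set set \<Rightarrow> ('v set set \<times> 'v \<times> 'v) set" where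
  "stars \<U> = (\<Union>C\<in>\<U>. star_of C)"

definition touching :: "'v set \<Rightarrow> 'v set set" where
  "touching C = {e \<in> E. e \<inter> C \<noteq> {}}"

lemma boundary_touching: "C \<in> comps \<Longrightarrow> boundary E C \<subseteq> touching C"
  using boundary_iff by (fastforce simp: touching_def)

lemma touching_disjoint:
  assumes "C \<in> comps" "C' \<in> comps" "C \<noteq> C'"
  shows "touching C \<inter> touching C' = {}"
  using edge_comps_unique[OF assms(1,2)] assms(3) by (auto simp: touching_def)

lemma finite_star_of: "C \<in> comps \<Longrightarrow> finite (star_of C)"
  by (simp add: star_of_def finite_boundary)

lemma finite_stars: "\<U> \<subseteq> comps \<Longrightarrow> finite (stars \<U>)"
  unfolding stars_def using finite_star_of finite_comps by (auto dest: finite_subset)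

lemma star_of_label: "p \<in> star_of C \<Longrightarrow> C \<in> comps \<Longrightarrow> fst p \<noteq> {} \<and> fst p \<subseteq> touching C"
  using boundary_touching[of C] by (auto simp: star_of_def)

text \<open>The state of the construction when the components in \<open>\<U>\<close> are still contracted: an edge
  \<open>(D, u, v)\<close> of \<open>K\<close> is to be routed inside the edge set \<open>D\<close>.\<close>

definition state :: "'v set set \<Rightarrow> ('v set set \<times> 'v \<times> 'v) set \<Rightarrow> 'v set \<Rightarrow> bool" where
  "state \<U> K X \<longleftrightarrow> finite K \<and> disjoint_labels K \<and>
     (\<forall>(D, u, v) \<in> K. D \<subseteq> E \<and> u \<in> A \<and> v \<in> A \<union> X \<and> u \<noteq> v \<and> joins D u v) \<and>
     (\<forall>p\<in>K. \<forall>C\<in>\<U>. fst p \<inter> touching C = {}) \<and>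
     finite X \<and> X \<subseteq> V - A \<and> (\<forall>C\<in>comps. card (X \<inter> C) \<le> 1) \<and> (\<forall>C\<in>\<U>. X \<inter> C = {}) \<and>
     (\<forall>x\<in>X. card {p \<in> K. snd (snd p) = x} = 3) \<and>
     (\<forall>u\<in>A. \<forall>v\<in>A. {u, v} \<in> E \<longrightarrow> ({{u, v}}, u, v) \<in> K \<or> ({{u, v}}, v, u) \<in> K) \<and>
     (\<forall>U. splits A U \<longrightarrow> m \<le> cut_size (K \<union> stars \<U>) U)"

lemma cut_size_star_of:
  assumes C: "C \<in> comps" and U: "rep C \<notin> U"
  shows "cut_size (star_of C) U = hits (boundary E C) A_end U"
proof -
  have "crossing (star_of C) U = (\<lambda>e. ({e}, A_end e, rep C)) ` {e \<in> boundary E C. A_end e \<in> U}"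
    unfolding star_of_def crossing_def using U by force
  moreover have "inj_on (\<lambda>e. ({e}, A_end e, rep C)) {e \<in> boundary E C. A_end e \<in> U}"
    by (rule inj_onI) simp
  ultimately show ?thesis by (simp add: cut_size_def hits_def card_image)
qed

text \<open>\<open>C\<close> is resolved as a star over the graph formed by \<open>K\<close> and the
  other stars. The new labels consist of edges meeting \<open>C\<close>; these occur neither in
  \<open>K\<close> nor at another component, so resolving can start with no edge in use.\<close>

lemma state_step:
  assumes st: "state \<U> K X" and C: "C \<in> \<U>" and sub: "\<U> \<subseteq> comps"
  shows "\<exists>K' X'. state (\<U> - {C}) K' X'"
proof -
  let ?W = "\<U> - {C}"
  have Cc: "C \<in> comps" using C sub by blast
  obtain r where rs: "ray_system E A C (boundary E C) r"
    and r: "\<And>e. e \<in> boundary E C \<Longrightarrow> e = {r e 0, r e 1}"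
    using rays_exist[OF Cc] by blast
  interpret R: ray_system E A C "boundary E C" r by (rule rs)
  have EC: "R.EC = touching C" by (simp add: R.EC_def touching_def)
  have A_end: "A_end e = r e 0" if e: "e \<in> boundary E C" for e
  proof -
    have "A_end {r e 0, r e 1} = r e 0"
      using R.start[OF e] R.tail[OF e, of 0] R.AC by (intro A_end_eq) auto
    then show ?thesis using r[OF e] by simp
  qed
  obtain K: "finite K" "disjoint_labels K" and X: "finite X" "X \<subseteq> V - A"
    and st': "\<forall>C\<in>comps. card (X \<inter> C) \<le> 1"
      "\<forall>(D, u, v) \<in> K. D \<subseteq> E \<and> u \<in> A \<and> v \<in> A \<union> X \<and> u \<noteq> v \<and> joins D u v"
      "\<forall>p\<in>K. \<forall>C\<in>\<U>. fst p \<inter> touching C = {}"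
      "\<forall>C\<in>\<U>. X \<inter> C = {}" "\<forall>x\<in>X. card {p \<in> K. snd (snd p) = x} = 3"
      "\<forall>U. splits A U \<longrightarrow> m \<le> cut_size (K \<union> stars \<U>) U"
    and KA: "\<forall>u\<in>A. \<forall>v\<in>A. {u, v} \<in> E \<longrightarrow> ({{u, v}}, u, v) \<in> K \<or> ({{u, v}}, v, u) \<in> K"
    using st unfolding state_def by (elim conjE)
  note KX = X st'(1)[rule_format] and Kto = st'(3)[rule_format] and XU = st'(4)[rule_format]
    and K3 = st'(5)[rule_format] and Kcut = st'(6)[rule_format]
  have Ked: "D \<subseteq> E \<and> u \<in> A \<and> v \<in> A \<union> X \<and> u \<noteq> v \<and> joins D u v" if "(D, u, v) \<in> K" for D u v
    using bspec[OF st'(2) that] by simp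
  let ?d = "cut_size (K \<union> stars ?W)"
  have fin: "finite (K \<union> stars ?W)" using K(1) finite_stars[of ?W] sub by auto
  have Kne: "fst p \<noteq> {}" if "p \<in> K" for p
    using that Ked[of "fst p" "fst (snd p)" "snd (snd p)"] joins_nonempty[of "fst p" "fst (snd p)" "snd (snd p)"] by simp
  have star_K: "star_of C' \<inter> K = {}" if "C' \<in> \<U>" for C'
  proof -
    have "p \<notin> K" if p: "p \<in> star_of C'" for p
      using star_of_label[OF p] Kto[of p C'] Kne[of p] that sub \<open>C' \<in> \<U>\<close> by blast
    then show ?thesis by blast
  qed
  have star_star: "star_of C \<inter> stars ?W = {}"
  proof -
    have "p \<notin> star_of C'" if p: "p \<in> star_of C" and C': "C' \<in> ?W" for p C'
    proof
      assume p': "p \<in> star_of C'"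
      have "touching C \<inter> touching C' = {}" using C' sub by (intro touching_disjoint[OF Cc]) auto
      then show False using star_of_label[OF p Cc] star_of_label[OF p'] C' sub by blast
    qed
    then show ?thesis unfolding stars_def by blast
  qed
  have no_rep: "fst (snd p) \<noteq> rep C \<and> snd (snd p) \<noteq> rep C" if p: "p \<in> K \<union> stars ?W" for p
    using p
  proof
    assume "p \<in> K"
    then have "fst (snd p) \<in> A" "snd (snd p) \<in> A \<union> X" using Ked[of "fst p" "fst (snd p)" "snd (snd p)"] by simp_all
    then show ?thesis using rep_in[OF Cc] R.AC XU[OF C] by auto
  next
    assume "p \<in> stars ?W"
    then obtain C' e where C': "C' \<in> \<U>" "C' \<noteq> C" and e: "e \<in> boundary E C'" "p = ({e}, A_end e, rep C')"
      by (auto simp: stars_def star_of_def)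
    have C'c: "C' \<in> comps" using C' sub by blast
    have "e \<inter> A \<noteq> {}" using e(1) boundary_iff[OF C'c] by auto
    then have "A_end e \<in> A" unfolding A_end_def by (metis IntD2 some_in_eq)
    moreover have "rep C' \<noteq> rep C"
      using comp_unique[OF C'c Cc rep_in[OF C'c]] rep_in[OF Cc] C'(2) by auto
    ultimately show ?thesis using e(2) rep_in[OF Cc] R.AC by auto
  qed
  have sub_rep: "?d (U - {rep C}) = ?d U" for U
  proof -
    have "crossing (K \<union> stars ?W) (U - {rep C}) = crossing (K \<union> stars ?W) U"
      using no_rep by (auto simp: crossing_def)
    then show ?thesis by (simp add: cut_size_def)
  qed
  have A_C: "rep C \<notin> A" using rep_in[OF Cc] R.AC by auto
  have "star A m ?d (boundary E C) (\<lambda>e. r e 0)"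
  proof
    show "even m" by (rule m)
    show "cut_function ?d" by (rule cut_function_cut_size[OF fin])
    show "finite (boundary E C)" by (rule R.finI)
    show "(\<lambda>e. r e 0) ` boundary E C \<subseteq> A" using R.start by blast
    fix U assume U: "splits A U"
    \<comment> \<open>The \<open>star\<close> condition concerns all \<open>U\<close>, but only the
      edges of the star of \<open>C\<close> end in \<open>rep C\<close>. Removing
      \<open>rep C\<close> from \<open>U\<close> hence changes no other crossing and places the
      contracted vertex outside.\<close>
    let ?U = "U - {rep C}"
    have "splits A ?U" using U A_C by (auto simp: splits_def)
    then have "m \<le> cut_size (K \<union> stars \<U>) ?U" by (rule Kcut)
    also have "K \<union> stars \<U> = (K \<union> stars ?W) \<union> star_of C" using C by (auto simp: stars_def)
    also have "cut_size \<dots> ?U = ?d ?U + cut_size (star_of C) ?U"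
      using fin finite_star_of[OF Cc] star_K[OF C] star_star by (intro cut_size_Un) auto
    also have "cut_size (star_of C) ?U = hits (boundary E C) A_end ?U"
      by (rule cut_size_star_of[OF Cc]) simp
    also have "hits (boundary E C) A_end ?U = hits (boundary E C) (\<lambda>e. r e 0) U"
    proof -
      have "r e 0 \<noteq> rep C" if "e \<in> boundary E C" for e using R.start[OF that] A_C by auto
      then have "{e \<in> boundary E C. A_end e \<in> ?U} = {e \<in> boundary E C. r e 0 \<in> U}"
        using A_end by auto
      then show ?thesis by (simp add: hits_def)
    qed
    finally show "m \<le> ?d U + hits (boundary E C) (\<lambda>e. r e 0) U" using sub_rep by simp
  qed
  moreover have "card (boundary E C) \<noteq> 1" using card_boundary[OF Cc] m by linarith
  ultimately obtain L Y where L: "R.resolves {} Y L"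
    and Lcut: "\<forall>U. splits A U \<longrightarrow> m \<le> ?d U + cut_size L U"
    using R.resolve_star[of m ?d "boundary E C" "{}"] by auto
  obtain Lfin: "finite L" "disjoint_labels L" and Y: "Y \<subseteq> C" "finite Y" "card Y \<le> 1"
    and L3: "\<forall>x\<in>Y. card {p \<in> L. snd (snd p) = x} = 3"
    and Lle: "\<forall>p\<in>L. R.linking_edge {} Y p"
    using L unfolding R.resolves_def by (elim conjE)
  have Led: "D \<subseteq> touching C \<and> u \<in> A \<and> v \<in> A \<union> Y \<and> u \<noteq> v \<and> joins D u v" if "(D, u, v) \<in> L" for D u v
    using bspec[OF Lle that] unfolding R.linking_edge_def EC by simp
  have Llab: "fst p \<subseteq> touching C" "fst p \<noteq> {}" if "p \<in> L" for p
    using that Led[of "fst p" "fst (snd p)" "snd (snd p)"] joins_nonempty[of "fst p" "fst (snd p)" "snd (snd p)"] by simp_all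
  have KL: "K \<inter> L = {}" "stars ?W \<inter> L = {}"
  proof -
    show "K \<inter> L = {}" using Llab Kto[OF _ C] by blast
    have "p \<notin> L" if p: "p \<in> star_of C'" and C': "C' \<in> ?W" for p C'
    proof
      assume "p \<in> L"
      have "touching C \<inter> touching C' = {}" using C' sub by (intro touching_disjoint[OF Cc]) auto
      then show False using star_of_label[OF p] Llab[OF \<open>p \<in> L\<close>] C' sub by blast
    qed
    then show "stars ?W \<inter> L = {}" unfolding stars_def by blast
  qed
  have CX: "X \<inter> C = {}" by (rule XU[OF C])
  have CA: "A \<inter> C = {}" by (rule R.AC)
  have "state ?W (K \<union> L) (X \<union> Y)"
    unfolding state_def
  proof (intro conjI)
    show "finite (K \<union> L)" "finite (X \<union> Y)" using K Lfin KX Y by simp_all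
    show "disjoint_labels (K \<union> L)"
      unfolding disjoint_labels_def
    proof (intro ballI impI)
      fix p q assume pq: "p \<in> K \<union> L" "q \<in> K \<union> L" "p \<noteq> q"
      have KL: "fst p \<inter> fst q = {}" if "p \<in> K" "q \<in> L" for p q
        using Kto[OF that(1) C] Llab(1)[OF that(2)] by blast
      have "p \<in> K \<and> q \<in> K \<or> p \<in> L \<and> q \<in> L \<or> p \<in> K \<and> q \<in> L \<or> q \<in> K \<and> p \<in> L" using pq by blast
      moreover have "fst p \<inter> fst q = {}" if "p \<in> K" "q \<in> K"
        using K(2) that pq(3) unfolding disjoint_labels_def by blast
      moreover have "fst p \<inter> fst q = {}" if "p \<in> L" "q \<in> L"
        using Lfin(2) that pq(3) unfolding disjoint_labels_def by blast
      ultimately show "fst p \<inter> fst q = {}" using KL[of p q] KL[of q p] by (metis Int_commute)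
    qed
    show "\<forall>(D, u, v) \<in> K \<union> L. D \<subseteq> E \<and> u \<in> A \<and> v \<in> A \<union> (X \<union> Y) \<and> u \<noteq> v \<and> joins D u v"
    proof (intro ballI)
      fix p assume "p \<in> K \<union> L"
      moreover obtain D u v where p: "p = (D, u, v)" by (cases p)
      ultimately have "D \<subseteq> E \<and> u \<in> A \<and> v \<in> A \<union> (X \<union> Y) \<and> u \<noteq> v \<and> joins D u v"
        using Ked[of D u v] Led[of D u v] by (auto simp: touching_def)
      then show "case p of (D, u, v) \<Rightarrow> D \<subseteq> E \<and> u \<in> A \<and> v \<in> A \<union> (X \<union> Y) \<and> u \<noteq> v \<and> joins D u v"
        using p by simp
    qed
    show "\<forall>p\<in>K \<union> L. \<forall>C'\<in>?W. fst p \<inter> touching C' = {}"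
    proof (intro ballI)
      fix p C' assume p: "p \<in> K \<union> L" and C': "C' \<in> ?W"
      have "touching C \<inter> touching C' = {}" using C' sub by (intro touching_disjoint[OF Cc]) auto
      then show "fst p \<inter> touching C' = {}" using p Kto[of p C'] Llab(1)[of p] C' by blast
    qed
    show "X \<union> Y \<subseteq> V - A" using KX Y(1) comp_subset[OF Cc] by blast
    show "\<forall>C'\<in>comps. card ((X \<union> Y) \<inter> C') \<le> 1"
    proof
      fix C' assume C': "C' \<in> comps"
      show "card ((X \<union> Y) \<inter> C') \<le> 1"
      proof (cases "C' = C")
        case True
        then have "(X \<union> Y) \<inter> C' = Y" using CX Y(1) by blast
        then show ?thesis using Y by simp
      next
        case False
        then have "Y \<inter> C' = {}" using comp_unique[OF C' Cc] Y(1) by blast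
        then have "(X \<union> Y) \<inter> C' = X \<inter> C'" by blast
        then show ?thesis using KX(3)[OF C'] by simp
      qed
    qed
    show "\<forall>C'\<in>?W. (X \<union> Y) \<inter> C' = {}"
    proof
      fix C' assume C': "C' \<in> ?W"
      then have "Y \<inter> C' = {}" using comp_unique[of C' C] Cc sub Y(1) by blast
      then show "(X \<union> Y) \<inter> C' = {}" using XU[of C'] C' by blast
    qed
    show "\<forall>x\<in>X \<union> Y. card {p \<in> K \<union> L. snd (snd p) = x} = 3"
    proof
      fix x assume x: "x \<in> X \<union> Y"
      show "card {p \<in> K \<union> L. snd (snd p) = x} = 3"
      proof (cases "x \<in> X")
        case True
        have "snd (snd p) \<noteq> x" if "p \<in> L" for p
          using Led[of "fst p" "fst (snd p)" "snd (snd p)"] that True CX Y(1) KX(2) by auto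
        then have "{p \<in> K \<union> L. snd (snd p) = x} = {p \<in> K. snd (snd p) = x}" by blast
        then show ?thesis using K3[OF True] by simp
      next
        case False
        then have xY: "x \<in> Y" using x by blast
        have "snd (snd p) \<noteq> x" if "p \<in> K" for p
          using Ked[of "fst p" "fst (snd p)" "snd (snd p)"] that False xY Y(1) CA by auto
        then have "{p \<in> K \<union> L. snd (snd p) = x} = {p \<in> L. snd (snd p) = x}" by blast
        then show ?thesis using bspec[OF L3 xY] by simp
      qed
    qed
    show "\<forall>u\<in>A. \<forall>v\<in>A. {u, v} \<in> E \<longrightarrow> ({{u, v}}, u, v) \<in> K \<union> L \<or> ({{u, v}}, v, u) \<in> K \<union> L"
      using KA by blast
    show "\<forall>U. splits A U \<longrightarrow> m \<le> cut_size (K \<union> L \<union> stars ?W) U"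
    proof (intro allI impI)
      fix U assume U: "splits A U"
      have "cut_size (K \<union> stars ?W \<union> L) U = ?d U + cut_size L U"
        using fin Lfin KL by (intro cut_size_Un) auto
      moreover have "K \<union> L \<union> stars ?W = K \<union> stars ?W \<union> L" by blast
      ultimately show "m \<le> cut_size (K \<union> L \<union> stars ?W) U" using Lcut U by simp
    qed
  qed
  then show ?thesis by blast
qed

text \<open>The choice merely orients each edge; cuts do not depend on it.\<close>

definition base :: "('v set set \<times> 'v \<times> 'v) set" where
  "base = (\<lambda>e. ({e}, SOME p. e = {fst p, snd p})) ` {e \<in> E. e \<subseteq> A}"

lemma baseE:
  assumes "p \<in> base"
  obtains e u v where "p = ({e}, u, v)" "e \<in> E" "e \<subseteq> A" "e = {u, v}" "u \<noteq> v"
proof -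
  obtain e where e: "e \<in> E" "e \<subseteq> A" "p = ({e}, SOME p. e = {fst p, snd p})"
    using assms by (auto simp: base_def)
  obtain x y where xy: "e = {x, y}" "x \<noteq> y" by (rule edgeE[OF e(1)])
  obtain u v where uv: "(SOME p. e = {fst p, snd p}) = (u, v)" by fastforce
  have "e = {fst (SOME p. e = {fst p, snd p}), snd (SOME p. e = {fst p, snd p})}"
    by (rule someI[of _ "(x, y)"]) (simp add: xy)
  then have "e = {u, v}" using uv by simp
  moreover from this have "u \<noteq> v" using xy by auto
  ultimately show thesis using that e uv by simp
qed

lemma base_edge:
  assumes "e \<in> E" "e \<subseteq> A"
  obtains u v where "({e}, u, v) \<in> base" "e = {u, v}"
proof -
  have "({e}, SOME p. e = {fst p, snd p}) \<in> base" using assms by (auto simp: base_def)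
  then show thesis using that by (rule_tac baseE) auto
qed

lemma state_initial: "state comps base {}"
  unfolding state_def
proof (intro conjI)
  have "{e \<in> E. e \<subseteq> A} \<subseteq> {e \<in> E. e \<inter> A \<noteq> {}}" by (auto elim: edgeE)
  then have "finite {e \<in> E. e \<subseteq> A}" using finite_touching[OF finA AV] by (rule finite_subset)
  then show fin: "finite base" by (simp add: base_def)
  show "disjoint_labels base" by (auto simp: disjoint_labels_def base_def)
  show "\<forall>(D, u, v) \<in> base. D \<subseteq> E \<and> u \<in> A \<and> v \<in> A \<union> {} \<and> u \<noteq> v \<and> joins D u v"
    by (auto elim!: baseE intro!: joins_edge)
  show "\<forall>p\<in>base. \<forall>C\<in>comps. fst p \<inter> touching C = {}"
    using comp_subset by (fastforce elim!: baseE simp: touching_def)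
  show "\<forall>u\<in>A. \<forall>v\<in>A. {u, v} \<in> E \<longrightarrow> ({{u, v}}, u, v) \<in> base \<or> ({{u, v}}, v, u) \<in> base"
  proof (intro ballI impI)
    fix u v assume "u \<in> A" "v \<in> A" "{u, v} \<in> E"
    then obtain x y where "({{u, v}}, x, y) \<in> base" "{u, v} = {x, y}"
      using base_edge[of "{u, v}"] by blast
    then show "({{u, v}}, u, v) \<in> base \<or> ({{u, v}}, v, u) \<in> base"
      by (auto simp: doubleton_eq_iff insert_commute)
  qed
  show "\<forall>U. splits A U \<longrightarrow> m \<le> cut_size (base \<union> stars comps) U"
  proof (intro allI impI)
    fix U assume U: "splits A U"
    let ?B = "base \<union> stars comps"
    \<comment> \<open>\<open>W\<close> is the preimage of \<open>U\<close> in \<open>G\<close>: a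
      component belongs to it as a whole when its \<open>rep\<close> is in \<open>U\<close>. Edges
      inside a component then never cross, and every edge of \<open>G\<close> across
      \<open>W\<close> is recovered from the label of a triple crossing \<open>U\<close>.\<close>
    define W where "W = (U \<inter> A) \<union> \<Union>{C \<in> comps. rep C \<in> U}"
    have AW: "x \<in> W \<longleftrightarrow> x \<in> U" if "x \<in> A" for x
      using that comp_subset by (auto simp: W_def)
    have CW: "x \<in> W \<longleftrightarrow> rep C \<in> U" if "x \<in> C" "C \<in> comps" for x C
      using that comp_subset[OF that(2)] comp_unique[OF that(2)] by (auto simp: W_def)
    let ?S = "{e \<in> E. e \<inter> W \<noteq> {} \<and> \<not> e \<subseteq> W}"
    have S: "\<exists>p\<in>crossing ?B U. fst p = {e}" if eS: "e \<in> ?S" for e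
    proof -
      have eE: "e \<in> E" using eS by simp
      obtain x y where xy: "e = {x, y}" "x \<in> W" "y \<notin> W"
      proof (rule edgeE[OF eE])
        fix u v assume "e = {u, v}"
        moreover from this have "u \<in> W \<and> v \<notin> W \<or> v \<in> W \<and> u \<notin> W" using eS by auto
        ultimately show thesis using that by (metis insert_commute)
      qed
      have V: "x \<in> V" "y \<in> V" using edge_subset[OF eE] xy(1) by simp_all
      have bd: "\<exists>p\<in>crossing ?B U. fst p = {e}"
        if e: "e = {u, w}" and u: "u \<in> A" and w: "w \<notin> A" "w \<in> V" and cr: "u \<in> W \<longleftrightarrow> w \<notin> W" for u w
      proof -
        obtain C where C: "C \<in> comps" "w \<in> C" using comp_exists[of w] w by blast
        have "e \<in> boundary E C" using boundary_iff[OF C(1)] e eE u C by blast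
        then have "({e}, A_end e, rep C) \<in> ?B" using C(1) by (auto simp: stars_def star_of_def)
        moreover have "A_end e = u" unfolding e by (rule A_end_eq[OF u w(1)])
        ultimately have "({e}, u, rep C) \<in> crossing ?B U"
          using AW[OF u] CW[OF C(2,1)] cr by (auto simp: crossing_def)
        then show ?thesis by force
      qed
      consider "x \<in> A" "y \<in> A" | "x \<in> A" "y \<notin> A" | "x \<notin> A" "y \<in> A" | "x \<notin> A" "y \<notin> A" by blast
      then show ?thesis
      proof cases
        case 1
        then obtain u v where "({e}, u, v) \<in> base" "e = {u, v}" using base_edge[OF eE] xy(1) by blast
        moreover from this have "(u \<in> U) \<noteq> (v \<in> U)" using xy AW 1 by (auto simp: doubleton_eq_iff)
        ultimately have "({e}, u, v) \<in> crossing ?B U" by (simp add: crossing_def)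
        then show ?thesis by force
      next
        case 2
        then show ?thesis using bd[of x y] xy V by simp
      next
        case 3
        then show ?thesis using bd[of y x] xy V by (simp add: insert_commute)
      next
        case 4
        then obtain C where C: "C \<in> comps" "x \<in> C" using comp_exists[of x] V by blast
        have "e \<inter> C \<noteq> {}" using xy C by blast
        then have "y \<in> C" using comp_edge[OF C(1) eE] 4 xy(1) by blast
        then show ?thesis using CW[OF C(2,1)] CW[OF _ C(1), of y] xy(2,3) by simp
      qed
    qed
    have finB: "finite ?B" using fin finite_stars by simp
    have sub: "?S \<subseteq> (\<lambda>p. the_elem (fst p)) ` crossing ?B U"
    proof
      fix e assume "e \<in> ?S"
      then obtain p where "p \<in> crossing ?B U" "fst p = {e}" using S by blast
      then show "e \<in> (\<lambda>p. the_elem (fst p)) ` crossing ?B U" by (intro image_eqI[of _ _ p]) simp_all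
    qed
    have fS: "finite ?S" by (rule finite_surj[OF finite_crossing[OF finB] sub])
    have "card ?S \<le> card (crossing ?B U)" by (rule surj_card_le[OF finite_crossing[OF finB] sub])
    then have "card ?S \<le> cut_size ?B U" by (simp add: cut_size_def)
    moreover obtain a b where "a \<in> A" "a \<in> U" "b \<in> A" "b \<notin> U" using U by (auto simp: splits_def)
    then have "m \<le> card ?S" using AW AV fS by (intro graph_cut[of a W b]) auto
    ultimately show "m \<le> cut_size ?B U" by simp
  qed
qed simp_all

lemma state_final: "\<exists>K X. state {} K X"
proof -
  have "\<exists>K X. state (comps - \<W>) K X" if "finite \<W>" "\<W> \<subseteq> comps" for \<W>
    using that
  proof (induction \<W> rule: finite_induct)
    case empty
    then show ?case using state_initial by auto
  next
    case (insert C \<W>)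
    then obtain K X where "state (comps - \<W>) K X" by auto
    moreover have "comps - insert C \<W> = (comps - \<W>) - {C}" by blast
    ultimately show ?case using state_step[of "comps - \<W>" K X C] insert by auto
  qed
  from this[OF finite_comps order_refl] show ?thesis by simp
qed

end

section \<open>The immersion\<close>

lemma card_indexed:
  assumes "bij_betw f F K"
  shows "card {i \<in> F. P (f i)} = card {p \<in> K. P p}"
proof (rule bij_betw_same_card)
  show "bij_betw f {i \<in> F. P (f i)} {p \<in> K. P p}"
    using assms by (auto simp: bij_betw_def inj_on_def)
qed

context linked_graph
begin

lemma immersion_of_state:
  assumes st: "state {} K X"
  shows "\<exists>F ends P. multigraph (A \<union> X) F ends \<and> medge_connected 3 (A \<union> X) F ends \<and>
     immersion V E (A \<union> X) F ends P \<and> (\<forall>x\<in>X. mdeg F ends x = 3) \<and>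
     (\<forall>a\<in>A. \<forall>b\<in>A. a \<noteq> b \<longrightarrow> mlambda F ends a b \<ge> m) \<and>
     (\<forall>a\<in>A. \<forall>b\<in>A. {a, b} \<in> E \<longrightarrow>
        (\<exists>i\<in>F. {fst (ends i), snd (ends i)} = {a, b} \<and> P i = [fst (ends i), snd (ends i)]))"
proof -
  obtain K: "finite K" "disjoint_labels K" and X: "finite X" "X \<subseteq> V - A"
    and Kedge: "\<forall>(D, u, v) \<in> K. D \<subseteq> E \<and> u \<in> A \<and> v \<in> A \<union> X \<and> u \<noteq> v \<and> joins D u v"
    and K3: "\<forall>x\<in>X. card {p \<in> K. snd (snd p) = x} = 3"
    and Kcut: "\<forall>U. splits A U \<longrightarrow> m \<le> cut_size (K \<union> stars {}) U"
    and KA: "\<forall>u\<in>A. \<forall>v\<in>A. {u, v} \<in> E \<longrightarrow> ({{u, v}}, u, v) \<in> K \<or> ({{u, v}}, v, u) \<in> K"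
    using st unfolding state_def by (elim conjE)
  define F where "F = {0..<card K}"
  obtain f where f: "bij_betw f F K" using ex_bij_betw_nat_finite[OF K(1)] F_def by blast
  define ends where "ends = snd \<circ> f"
  have fK: "f i \<in> K" if "i \<in> F" for i using f that by (auto simp: bij_betw_def)
  have edge: "fst (f i) \<subseteq> E" "fst (ends i) \<in> A" "snd (ends i) \<in> A \<union> X" "fst (ends i) \<noteq> snd (ends i)"
    "joins (fst (f i)) (fst (ends i)) (snd (ends i))" if "i \<in> F" for i
    using bspec[OF Kedge fK[OF that]] by (auto simp: ends_def case_prod_beta)
  have crossing: "card {i \<in> F. (fst (ends i) \<in> U) \<noteq> (snd (ends i) \<in> U)} = cut_size K U" for U
    using card_indexed[OF f, of "\<lambda>p. (fst (snd p) \<in> U) \<noteq> (snd (snd p) \<in> U)"]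
    by (simp only: ends_def comp_apply cut_size_def crossing_def)
  have Acut: "m \<le> cut_size K U" if "splits A U" for U using Kcut that by (simp add: stars_def)
  have finF: "finite F" by (simp add: F_def)
  have mult: "multigraph (A \<union> X) F ends"
    unfolding multigraph_def using finF finA X edge by simp
  have deg: "card {i \<in> F. snd (ends i) = x} = 3" if "x \<in> X" for x
    using card_indexed[OF f, of "\<lambda>p. snd (snd p) = x"] bspec[OF K3 that] by (simp add: ends_def)
  have deg': "mdeg F ends x = 3" if x: "x \<in> X" for x
  proof -
    have "fst (ends i) \<noteq> x" if "i \<in> F" for i using edge(2)[OF that] X(2) x by auto
    then have "{i \<in> F. fst (ends i) = x \<or> snd (ends i) = x} = {i \<in> F. snd (ends i) = x}" by blast
    then show ?thesis using deg[OF x] by (simp add: mdeg_def)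
  qed
  \<comment> \<open>If \<open>U\<close> does not split \<open>A\<close>, then \<open>U\<close> or
    its complement misses \<open>A\<close> but contains some \<open>x\<close> in \<open>X\<close>,
    and the three edges at \<open>x\<close> all lead to \<open>A\<close>.\<close>
  have cut3: "3 \<le> card {i \<in> F. (fst (ends i) \<in> U) \<noteq> (snd (ends i) \<in> U)}"
    if U: "U \<inter> (A \<union> X) \<noteq> {}" "\<not> A \<union> X \<subseteq> U" for U
  proof -
    have *: "3 \<le> card {i \<in> F. (fst (ends i) \<in> U) \<noteq> (snd (ends i) \<in> U)}"
      if x: "x \<in> X" "x \<in> U" and A: "A \<inter> U = {}" for x U
    proof -
      have "{i \<in> F. snd (ends i) = x} \<subseteq> {i \<in> F. (fst (ends i) \<in> U) \<noteq> (snd (ends i) \<in> U)}"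
        using edge(2) x A by auto
      then have "card {i \<in> F. snd (ends i) = x} \<le> card {i \<in> F. (fst (ends i) \<in> U) \<noteq> (snd (ends i) \<in> U)}"
        using finF by (intro card_mono) auto
      then show ?thesis using deg[OF x(1)] by simp
    qed
    consider "splits A U" | "A \<inter> U = {}" | "A \<subseteq> U" by (auto simp: splits_def)
    then show ?thesis
    proof cases
      case 1
      then show ?thesis using Acut[of U] m(2) unfolding crossing by simp
    next
      case 2
      then obtain x where "x \<in> X" "x \<in> U" using U(1) by blast
      then show ?thesis using *[of x U] 2 by blast
    next
      case 3
      then obtain x where "x \<in> X" "x \<in> - U" using U(2) by blast
      then have "3 \<le> card {i \<in> F. (fst (ends i) \<in> - U) \<noteq> (snd (ends i) \<in> - U)}"
        using *[of x "- U"] 3 by blast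
      then show ?thesis unfolding crossing cut_size_Compl .
    qed
  qed
  have conn: "medge_connected 3 (A \<union> X) F ends"
    unfolding medge_connected_def
  proof (intro allI impI ballI, rule ccontr)
    fix S u v
    let ?R = "\<lambda>x y. \<exists>i \<in> F - S. ends i = (x, y) \<or> ends i = (y, x)"
    assume S: "S \<subseteq> F \<and> card S < 3" and u: "u \<in> A \<union> X" and v: "v \<in> A \<union> X" and no: "\<not> ?R\<^sup>*\<^sup>* u v"
    let ?U = "{w. ?R\<^sup>*\<^sup>* u w}"
    have "{i \<in> F. (fst (ends i) \<in> ?U) \<noteq> (snd (ends i) \<in> ?U)} \<subseteq> S"
    proof (rule subsetI, rule ccontr)
      fix i assume i: "i \<in> {i \<in> F. (fst (ends i) \<in> ?U) \<noteq> (snd (ends i) \<in> ?U)}" "i \<notin> S"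
      then have R: "?R (fst (ends i)) (snd (ends i))" "?R (snd (ends i)) (fst (ends i))"
        by (auto intro!: bexI[of _ i])
      have "fst (ends i) \<in> ?U \<longleftrightarrow> snd (ends i) \<in> ?U"
        using rtranclp.rtrancl_into_rtrancl[of ?R u, OF _ R(1)]
          rtranclp.rtrancl_into_rtrancl[of ?R u, OF _ R(2)] by (simp only: mem_Collect_eq) blast
      then show False using i(1) by simp
    qed
    moreover have "finite S" using S finF finite_subset by blast
    ultimately have "card {i \<in> F. (fst (ends i) \<in> ?U) \<noteq> (snd (ends i) \<in> ?U)} \<le> card S"
      by (intro card_mono)
    moreover have "?U \<inter> (A \<union> X) \<noteq> {}" using u by blast
    moreover have "\<not> A \<union> X \<subseteq> ?U" using v no by blast
    ultimately show False using cut3[of ?U] S by linarith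
  qed
  have lam: "m \<le> mlambda F ends a b" if ab: "a \<in> A" "b \<in> A" "a \<noteq> b" for a b
  proof (rule mlambda_ge[OF mult ab(3)])
    fix U assume "a \<in> U" "b \<notin> U"
    then have "splits A U" using ab by (auto simp: splits_def)
    then show "m \<le> card {i \<in> F. (fst (ends i) \<in> U) \<noteq> (snd (ends i) \<in> U)}"
      unfolding crossing by (rule Acut)
  qed
  have "\<exists>xs. gpath V E xs \<and> hd xs = fst (ends i) \<and> last xs = snd (ends i) \<and> path_edges xs \<subseteq> fst (f i) \<and>
      ({fst (ends i), snd (ends i)} \<in> fst (f i) \<longrightarrow> xs = [fst (ends i), snd (ends i)])" if i: "i \<in> F" for i
  proof -
    have "fst (ends i) \<in> V" using edge(2)[OF i] AV by blast
    then obtain xs where "gpath V E xs" "hd xs = fst (ends i)" "last xs = snd (ends i)"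
      "path_edges xs \<subseteq> fst (f i)"
      "{fst (ends i), snd (ends i)} \<in> fst (f i) \<Longrightarrow> xs = [fst (ends i), snd (ends i)]"
      using joins_gpath[OF edge(5)[OF i] edge(1)[OF i] _ edge_subset edge(4)[OF i]] by blast
    then show ?thesis by blast
  qed
  then obtain P where P: "\<And>i. i \<in> F \<Longrightarrow> gpath V E (P i) \<and> hd (P i) = fst (ends i) \<and>
      last (P i) = snd (ends i) \<and> path_edges (P i) \<subseteq> fst (f i) \<and>
      ({fst (ends i), snd (ends i)} \<in> fst (f i) \<longrightarrow> P i = [fst (ends i), snd (ends i)])"
    by metis
  have imm: "immersion V E (A \<union> X) F ends P"
    unfolding immersion_def
  proof (intro conjI ballI impI)
    show "A \<union> X \<subseteq> V" using AV X(2) by blast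
    fix i assume i: "i \<in> F"
    show "gpath V E (P i)" "hd (P i) = fst (ends i)" "last (P i) = snd (ends i)" using P[OF i] by blast+
    fix j assume j: "j \<in> F" "i \<noteq> j"
    then have "f i \<noteq> f j" using f i by (auto simp: bij_betw_def inj_on_def)
    then have "fst (f i) \<inter> fst (f j) = {}"
      using K(2) fK[OF i] fK[OF j(1)] unfolding disjoint_labels_def by blast
    then show "path_edges (P i) \<inter> path_edges (P j) = {}" using P[OF i] P[OF j(1)] by blast
  qed
  have AA: "\<exists>i\<in>F. {fst (ends i), snd (ends i)} = {a, b} \<and> P i = [fst (ends i), snd (ends i)]"
    if ab: "a \<in> A" "b \<in> A" "{a, b} \<in> E" for a b
  proof -
    have "({{a, b}}, a, b) \<in> K \<or> ({{a, b}}, b, a) \<in> K" using KA ab by simp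
    moreover have "{b, a} = {a, b}" by (rule insert_commute)
    ultimately obtain u v where uv: "({{a, b}}, u, v) \<in> K" "{u, v} = {a, b}" by blast
    then have "({{a, b}}, u, v) \<in> f ` F" using f by (simp add: bij_betw_def)
    then obtain i where i: "i \<in> F" "f i = ({{a, b}}, u, v)" by auto
    then have "ends i = (u, v)" by (simp add: ends_def)
    then show ?thesis using P[OF i(1)] i uv(2) by (intro bexI[of _ i]) simp_all
  qed
  show ?thesis
    by (intro exI[of _ F] exI[of _ ends] exI[of _ P] conjI ballI impI mult conn imm deg' lam AA)
qed

end

theorem theorem3p2:
  fixes V :: "'v set" and E :: "'v set set" and A :: "'v set" and k :: nat
  assumes "k \<ge> 2"
    and "simple_graph V E"
    and "locally_finite V E"
    and "edge_connected (2 * k) V E"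
    and "finite A" and "A \<subseteq> V"
    and "\<forall>C. component_minus V E A C \<longrightarrow> boundary_linked V E C"
  shows "\<exists>X F ends P.
     X \<subseteq> V - A \<and>
     (\<forall>C. component_minus V E A C \<longrightarrow> card (X \<inter> C) \<le> 1) \<and>
     multigraph (A \<union> X) F ends \<and>
     medge_connected 3 (A \<union> X) F ends \<and>
     immersion V E (A \<union> X) F ends P \<and>
     (\<forall>x\<in>X. mdeg F ends x = 3) \<and>
     (\<forall>a\<in>A. \<forall>b\<in>A. a \<noteq> b \<longrightarrow> mlambda F ends a b \<ge> 2 * k) \<and>
     (\<forall>a\<in>A. \<forall>b\<in>A. {a, b} \<in> E \<longrightarrow>
        (\<exists>i\<in>F. {fst (ends i), snd (ends i)} = {a, b} \<and> P i = [fst (ends i), snd (ends i)]))"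
proof (cases "A = {}")
  case True
  show ?thesis
    by (rule exI[of _ "{}"], rule exI[of _ "{}"])
      (simp add: True multigraph_def medge_connected_def immersion_def)
next
  case False
  interpret linked_graph V E A "2 * k"
    by unfold_locales (use assms False in auto)
  obtain K X where st: "state {} K X" using state_final by blast
  obtain X: "X \<subseteq> V - A" "\<forall>C\<in>comps. card (X \<inter> C) \<le> 1"
    using st unfolding state_def by (elim conjE)
  have "\<forall>C. component_minus V E A C \<longrightarrow> card (X \<inter> C) \<le> 1"
    using X(2) by (simp add: comps_def)
  then show ?thesis using immersion_of_state[OF st] X(1) by (intro exI[of _ X]) simp
qed

end
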